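(* Let $\Gamma=\{g_1,\ldots,g_k\}\subset H^+$ be admissible and contractive and let $p=(p_1,\ldots,p_k)$ be a probability distribution on $\Gamma$ with all $p_i>0$. Then the Iterated Function System $(\Gamma,p)$ is asymptotically stable.
   Context: $\mathbf{S}^1$ is the circle with arc length normalized so that the total length is $1$; $|I|$ is the length of an arc $I$. $H^+$ is the set of orientation preserving homeomorphisms of $\mathbf{S}^1$. $C(\mathbf{S}^1)$ is the space of continuous real functions on $\mathbf{S}^1$ with the supremum norm. $\mathcal{M}_1$ and $\mathcal{M}_{fin}$ are the sets of Borel probability measures and finite Borel measures on $\mathbf{S}^1$. $\Gamma=\{g_1,\ldots,g_k\}\subset H^+$ is a finite collection and $p(g_i)=p_i>0$, $\sum_i p_i=1$. The pair $(\Gamma,p)$ is called an Iterated Function System; its Markov operator is $P:\mathcal{M}_{fin}\to\mathcal{M}_{fin}$, $P\mu=\sum_{i=1}^k p_i\,\mu\circ g_i^{-1}$, where $(\mu\circ g^{-1})(A)=\mu(g^{-1}(A))$ for Borel $A$. $\Gamma$ is admissible if one of its elements, labelled $g_1$, is such that $\{g_1^n(x):n\ge1\}$ is dense in $\mathbf{S}^1$ for some (and thus all) $x\in\mathbf{S}^1$. $\Sigma_*$ is the set of all finite words over $\{1,\ldots,k\}$ of length at least $1$; for $\mathbf{i}=(i_1,\ldots,i_n)\in\Sigma_*$ put $g_{\mathbf{i}}=g_{i_n}\circ g_{i_{n-1}}\circ\cdots\circ g_{i_1}$. $\Gamma$ (its action) is contractive if for each $x\in\mathbf{S}^1$ there exist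 an open interval $I\subset\mathbf{S}^1$ containing $x$ and a sequence $(\mathbf{i}_m)_{m\in\mathbb{N}}$ in $\Sigma_*$ such that $|g_{\mathbf{i}_m}(I)|\to0$ as $m\to\infty$. A measure $\mu_*$ is invariant if $P\mu_*=\mu_*$. $P$ (and $(\Gamma,p)$) is asymptotically stable if there exists a unique invariant measure $\mu_*\in\mathcal{M}_1$ and it satisfies $\lim_{n\to\infty}\int_{\mathbf{S}^1} f\,dP^n\mu=\int_{\mathbf{S}^1} f\,d\mu_*$ for all $f\in C(\mathbf{S}^1)$ and $\mu\in\mathcal{M}_1$. *)

theory Defs
  imports "HOL-Probability.Probability"
begin

abbreviation circle :: "complex set" where
  "circle \<equiv> sphere 0 1"

definition circle_param :: "real \<Rightarrow> complex" where
  "circle_param t = cis (2 * pi * t)"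

definition open_arc :: "complex set \<Rightarrow> bool" where
  "open_arc I \<longleftrightarrow> (\<exists>a b. a < b \<and> b \<le> a + 1 \<and> I = circle_param ` {a<..<b})"

definition arc_length :: "complex set \<Rightarrow> real" where
  "arc_length A = measure lborel {t \<in> {0..<1}. circle_param t \<in> A}"

lemma circle_param_eq_iff: "circle_param s = circle_param t \<longleftrightarrow> (\<exists>n::int. s = t + n)"
proof
  assume "circle_param s = circle_param t"
  then have "sin (2 * pi * s) = sin (2 * pi * t) \<and> cos (2 * pi * s) = cos (2 * pi * t)"
    unfolding circle_param_def by (metis cis.sel)
  then obtain n :: int where "2 * pi * s = 2 * pi * t + 2 * pi * n"
    unfolding sin_cos_eq_iff by auto
  then have "2 * pi * s = 2 * pi * (t + n)"
    by (simp only: distrib_left)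
  then show "\<exists>n::int. s = t + n"
    by auto
next
  assume "\<exists>n::int. s = t + n"
  then obtain n :: int where "s = t + n" ..
  then have "2 * pi * s = 2 * pi * t + 2 * pi * n"
    by (simp add: distrib_left)
  then have "sin (2 * pi * s) = sin (2 * pi * t) \<and> cos (2 * pi * s) = cos (2 * pi * t)"
    unfolding sin_cos_eq_iff by blast
  then show "circle_param s = circle_param t"
    by (simp add: circle_param_def complex_eq_iff)
qed

lemma arc_length_arc:
  assumes "a < b" "b \<le> a + 1"
  shows "arc_length (circle_param ` {a<..<b}) = b - a"
proof -
  define c d where "c = a - \<lfloor>a\<rfloor>" and "d = b - \<lfloor>a\<rfloor>"
  have c: "0 \<le> c" "c < 1" "c < d" "d \<le> c + 1"
    using assms unfolding c_def d_def by linarith+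
  have mem: "circle_param t \<in> circle_param ` {a<..<b} \<longleftrightarrow> t \<in> {c<..<d} \<or> t + 1 \<in> {c<..<d}"
    if t: "t \<in> {0..<1}" for t
  proof
    assume "circle_param t \<in> circle_param ` {a<..<b}"
    then obtain s where s: "a < s" "s < b" "circle_param t = circle_param s"
      by auto
    then obtain n :: int where n: "t = s + n"
      using circle_param_eq_iff by blast
    define m :: int where "m = - n - \<lfloor>a\<rfloor>"
    have tm: "t + m \<in> {c<..<d}"
      using s n unfolding c_def d_def m_def by auto
    then have "m = 0 \<or> m = 1"
      using t c by auto
    then show "t \<in> {c<..<d} \<or> t + 1 \<in> {c<..<d}"
      using tm by auto
  next
    assume "t \<in> {c<..<d} \<or> t + 1 \<in> {c<..<d}"
    then obtain m :: int where "t + m \<in> {c<..<d}"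
      by (metis add.right_neutral of_int_0 of_int_1)
    then have m: "t + (m + \<lfloor>a\<rfloor>) \<in> {a<..<b}"
      unfolding c_def d_def by auto
    have "t = (t + (m + \<lfloor>a\<rfloor>)) + of_int (- m - \<lfloor>a\<rfloor>)"
      by simp
    then have "circle_param t = circle_param (t + (m + \<lfloor>a\<rfloor>))"
      unfolding circle_param_eq_iff by blast
    then show "circle_param t \<in> circle_param ` {a<..<b}"
      using m by blast
  qed
  have "{t \<in> {0..<1}. circle_param t \<in> circle_param ` {a<..<b}} =
      {t \<in> {0..<1}. t \<in> {c<..<d} \<or> t + 1 \<in> {c<..<d}}" (is "?S = ?T")
    using mem by blast
  moreover have "measure lborel ?T = d - c"
  proof (cases "d \<le> 1")
    case True
    have "?T = {c<..<d}"
      using True c by auto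
    then show ?thesis
      using c by simp
  next
    case False
    have eq: "?T = {0..<d - 1} \<union> {c<..<1}"
      using False c by auto
    have "measure lborel ({0..<d - 1} \<union> {c<..<1}) =
        measure lborel {0..<d - 1} + measure lborel {c<..<1}"
      using c False by (intro measure_Union) auto
    then show ?thesis
      unfolding eq using c False by simp
  qed
  ultimately show ?thesis
    by (simp add: arc_length_def c_def d_def)
qed

text \<open>
  Orientation preservation is expressed by an increasing lift to the universal cover.
  Maps of the circle are total functions on \<^typ>\<open>complex\<close>; their values off the circle
  are irrelevant.
\<close>

definition homeo_plus :: "(complex \<Rightarrow> complex) set" where
  "homeo_plus = {f. (\<exists>h. homeomorphism circle circle f h) \<and>
     (\<exists>F :: real \<Rightarrow> real. continuous_on UNIV F \<and> strict_mono F \<and> (\<forall>t. F (t + 1) = F t + 1) \<and>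
        (\<forall>t. f (circle_param t) = circle_param (F t)))}"

abbreviation circle_borel :: "complex measure" where
  "circle_borel \<equiv> restrict_space borel circle"

definition finite_measures :: "complex measure set" where
  "finite_measures = {\<mu>. sets \<mu> = sets circle_borel \<and> finite_measure \<mu>}"

definition prob_measures :: "complex measure set" where
  "prob_measures = {\<mu>. sets \<mu> = sets circle_borel \<and> prob_space \<mu>}"

text \<open>
  The system \<open>g\<^sub>1, \<dots>, g\<^sub>k\<close> with weights \<open>p\<^sub>1, \<dots>, p\<^sub>k\<close> is given by families \<open>g\<close> and \<open>p\<close> of which
  only the values on \<open>{1..k}\<close> matter.
\<close>

definition markov_op ::
  "nat \<Rightarrow> (nat \<Rightarrow> complex \<Rightarrow> complex) \<Rightarrow> (nat \<Rightarrow> real) \<Rightarrow> complex measure \<Rightarrow> complex measure" where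
  "markov_op k g p \<mu> = measure_of circle (sets circle_borel)
     (\<lambda>A. \<Sum>i = 1..k. ennreal (p i) * emeasure \<mu> (g i -` A \<inter> circle))"

definition admissible :: "nat \<Rightarrow> (nat \<Rightarrow> complex \<Rightarrow> complex) \<Rightarrow> bool" where
  "admissible k g \<longleftrightarrow>
     (\<exists>i \<in> {1..k}. \<exists>x \<in> circle. circle \<subseteq> closure {(g i ^^ n) x | n. n \<ge> 1})"

definition words :: "nat \<Rightarrow> nat list set" where
  "words k = {w. w \<noteq> [] \<and> set w \<subseteq> {1..k}}"

text \<open>Note that \<open>fold g [i\<^sub>1, \<dots>, i\<^sub>n] = g i\<^sub>n \<circ> \<dots> \<circ> g i\<^sub>1\<close>.\<close>

definition contractive :: "nat \<Rightarrow> (nat \<Rightarrow> complex \<Rightarrow> complex) \<Rightarrow> bool" where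
  "contractive k g \<longleftrightarrow>
     (\<forall>x \<in> circle. \<exists>I. open_arc I \<and> x \<in> I \<and>
        (\<exists>w :: nat \<Rightarrow> nat list. (\<forall>m. w m \<in> words k) \<and>
           (\<lambda>m. arc_length (fold g (w m) ` I)) \<longlonglongrightarrow> 0))"

definition invariant_measure ::
  "nat \<Rightarrow> (nat \<Rightarrow> complex \<Rightarrow> complex) \<Rightarrow> (nat \<Rightarrow> real) \<Rightarrow> complex measure \<Rightarrow> bool" where
  "invariant_measure k g p \<mu> \<longleftrightarrow> markov_op k g p \<mu> = \<mu>"

definition asymptotically_stable ::
  "nat \<Rightarrow> (nat \<Rightarrow> complex \<Rightarrow> complex) \<Rightarrow> (nat \<Rightarrow> real) \<Rightarrow> bool" where
  "asymptotically_stable k g p \<longleftrightarrow>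
     (\<exists>\<mu>s \<in> prob_measures. invariant_measure k g p \<mu>s \<and>
        (\<forall>\<nu> \<in> prob_measures. invariant_measure k g p \<nu> \<longrightarrow> \<nu> = \<mu>s) \<and>
        (\<forall>f :: complex \<Rightarrow> real. \<forall>\<mu> \<in> prob_measures. continuous_on circle f \<longrightarrow>
           (\<lambda>n. \<integral>x. f x \<partial>((markov_op k g p ^^ n) \<mu>)) \<longlonglongrightarrow> (\<integral>x. f x \<partial>\<mu>s)))"

lemma homeo_plus_measurable:
  assumes "f \<in> homeo_plus"
  shows "f \<in> circle_borel \<rightarrow>\<^sub>M circle_borel"
proof -
  have "continuous_on circle f" "f ` circle = circle"
    using assms by (auto simp: homeo_plus_def homeomorphism_def)
  then show ?thesis
    by (intro measurable_restrict_space2 borel_measurable_continuous_on_restrict)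
      (auto simp: space_restrict_space)
qed

text \<open>
  The set function in \<^const>\<open>markov_op\<close> is countably additive, so that \<^const>\<open>measure_of\<close>
  does not fall back to the null measure.
\<close>

lemma sets_markov_op [simp]: "sets (markov_op k g p \<mu>) = sets circle_borel"
proof -
  have "sets circle_borel \<subseteq> Pow circle"
    using sets.space_closed[of circle_borel] by (simp add: space_restrict_space)
  then have "sets (markov_op k g p \<mu>) = sigma_sets circle (sets circle_borel)"
    unfolding markov_op_def by simp
  also have "\<dots> = sets circle_borel"
    using sets.sigma_sets_eq[of circle_borel] by (simp add: space_restrict_space)
  finally show ?thesis .
qed

lemma emeasure_markov_op:
  assumes g: "\<And>i. i \<in> {1..k} \<Longrightarrow> g i \<in> homeo_plus"
    and \<mu>: "sets \<mu> = sets circle_borel" and A: "A \<in> sets circle_borel"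
  shows "emeasure (markov_op k g p \<mu>) A =
    (\<Sum>i = 1..k. ennreal (p i) * emeasure \<mu> (g i -` A \<inter> circle))"
proof -
  let ?m = "\<lambda>A. \<Sum>i = 1..k. ennreal (p i) * emeasure \<mu> (g i -` A \<inter> circle)"
  have sp: "space \<mu> = circle"
    using sets_eq_imp_space_eq[OF \<mu>] by (simp add: space_restrict_space)
  have meas: "g i \<in> \<mu> \<rightarrow>\<^sub>M circle_borel" if "i \<in> {1..k}" for i
    using homeo_plus_measurable[OF g[OF that]] \<mu> by (simp cong: measurable_cong_sets)
  have distr: "emeasure \<mu> (g i -` B \<inter> circle) = emeasure (distr \<mu> circle_borel (g i)) B"
    if "i \<in> {1..k}" "B \<in> sets circle_borel" for i B
    using that meas by (simp add: emeasure_distr sp)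
  have "countably_additive (sets circle_borel) ?m"
  proof (rule countably_additiveI)
    fix B :: "nat \<Rightarrow> complex set"
    assume B: "range B \<subseteq> sets circle_borel" "disjoint_family B" "\<Union> (range B) \<in> sets circle_borel"
    have "(\<Sum>n. ?m (B n)) = (\<Sum>i = 1..k. \<Sum>n. ennreal (p i) * emeasure \<mu> (g i -` B n \<inter> circle))"
      by (intro suminf_sum) simp
    also have "\<dots> = (\<Sum>i = 1..k. ennreal (p i) * (\<Sum>n. emeasure (distr \<mu> circle_borel (g i)) (B n)))"
      using B distr by (intro sum.cong refl) (auto simp: range_subsetD)
    also have "\<dots> = (\<Sum>i = 1..k. ennreal (p i) * emeasure (distr \<mu> circle_borel (g i)) (\<Union> (range B)))"
      using B by (intro sum.cong refl arg_cong2[where f = "(*)"] suminf_emeasure) auto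
    also have "\<dots> = ?m (\<Union> (range B))"
      using B distr by (intro sum.cong refl) auto
    finally show "(\<Sum>n. ?m (B n)) = ?m (\<Union> (range B))" .
  qed
  moreover have "positive (sets circle_borel) ?m"
    by (simp add: positive_def)
  moreover have "sigma_algebra circle (sets circle_borel)"
    using sets.sigma_algebra_axioms[of circle_borel] by (simp add: space_restrict_space)
  ultimately show ?thesis
    unfolding markov_op_def using A by (intro emeasure_measure_of_sigma)
qed

lemma markov_op_finite_measures:
  assumes "\<And>i. i \<in> {1..k} \<Longrightarrow> g i \<in> homeo_plus" and \<mu>: "\<mu> \<in> finite_measures"
  shows "markov_op k g p \<mu> \<in> finite_measures"
proof -
  interpret finite_measure \<mu>
    using \<mu> by (simp add: finite_measures_def)
  have sp: "space (markov_op k g p \<mu>) = circle"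
    using sets_eq_imp_space_eq[OF sets_markov_op] by (simp add: space_restrict_space)
  have "emeasure (markov_op k g p \<mu>) circle \<noteq> \<infinity>"
    using assms emeasure_markov_op[of k g \<mu> circle p] sets.top[of circle_borel]
    by (simp add: finite_measures_def space_restrict_space ennreal_mult_eq_top_iff)
  then show ?thesis
    by (auto simp: finite_measures_def sp intro!: finite_measureI)
qed

end

theory Submission
  imports Defs
begin

text \<open>
  Let \<open>U f = \<Sum>\<^sub>i p\<^sub>i f \<circ> g\<^sub>i\<close> be the dual of the Markov operator. A stationary measure \<open>\<nu>\<close> of the inverse
  system \<open>(g\<^sub>i\<^sup>-\<^sup>1, p\<^sub>i)\<close> satisfies \<open>\<nu>(A) = \<Sum>\<^sub>i p\<^sub>i \<nu>(g\<^sub>i A)\<close>; minimality of \<open>g\<^sub>1\<close> makes it atomless with full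
  support, so \<open>\<nu>\<close>-length of arcs is a distance for the topology that is preserved on average, and
  the iterates \<open>U\<^sup>n f\<close> of a continuous \<open>f\<close> are equicontinuous. For a stationary measure \<open>\<mu>\<close> of the
  system itself, \<open>\<integral> (U\<^sup>n f)\<^sup>2 d\<mu>\<close> is decreasing and its decrements are
  \<open>\<Sum>\<^sub>i p\<^sub>i \<integral> (U\<^sup>n f \<circ> g\<^sub>i - U\<^sup>n\<^sup>+\<^sup>1 f)\<^sup>2 d\<mu>\<close>. As \<open>\<mu>\<close> has full support, equicontinuity yields
  \<open>U\<^sup>n f \<circ> g\<^sub>w - U\<^sup>n\<^sup>+\<^sup>|\<^sup>w\<^sup>| f \<rightarrow> 0\<close> pointwise for every word \<open>w\<close>. Choosing \<open>w\<close> contracting an arc shows that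
  \<open>U\<^sup>n f(x) - U\<^sup>n f(y) \<rightarrow> 0\<close> for nearby \<open>x, y\<close>, hence for all \<open>x, y\<close> by connectedness, and therefore
  \<open>U\<^sup>n f \<rightarrow> \<integral> f d\<mu>\<close> pointwise.
\<close>

section \<open>The circle and its measures\<close>

lemma norm_circle_param [simp]: "norm (circle_param t) = 1"
  by (simp add: circle_param_def)

lemma circle_param_in_circle: "circle_param t \<in> circle"
  by simp

lemma circle_param_add_int [simp]: "circle_param (t + of_int n) = circle_param t"
  unfolding circle_param_eq_iff by blast

text \<open>The free left end \<open>a\<close> allows the representative to be taken in any
  fundamental domain, in particular to the right of a given parameter.\<close>

lemma circle_param_surj:
  assumes "z \<in> circle"
  obtains t where "a \<le> t" "t < a + 1" "z = circle_param t"
proof -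
  have z: "z = circle_param (Arg z / (2 * pi))"
  proof -
    have "z \<noteq> 0" "sgn z = z"
      using assms by (auto simp: sgn_div_norm)
    then show ?thesis
      using cis_Arg[of z] by (simp add: circle_param_def)
  qed
  let ?t = "a + frac (Arg z / (2 * pi) - a)"
  have "?t = Arg z / (2 * pi) + of_int (- \<lfloor>Arg z / (2 * pi) - a\<rfloor>)"
    by (simp add: frac_def)
  then have "circle_param ?t = z"
    using z circle_param_add_int by metis
  moreover have "a \<le> ?t" "?t < a + 1"
    using frac_lt_1 frac_ge_0 by auto
  ultimately show ?thesis
    using that by metis
qed

lemma continuous_circle_param: "continuous_on A circle_param"
  unfolding circle_param_def by (intro continuous_intros)

text \<open>A chord is no longer than its arc; \<open>2 * pi\<close> is the speed of the
  parametrization.\<close>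

lemma dist_circle_param_le: "dist (circle_param s) (circle_param t) \<le> 2 * pi * \<bar>s - t\<bar>"
proof -
  have "cis a - cis b = cis b * (exp (\<i> * complex_of_real (a - b)) - 1)" for a b
    by (simp add: cis_conv_exp algebra_simps flip: exp_add)
  then have "norm (cis a - cis b) = 2 * \<bar>sin ((a - b) / 2)\<bar>" for a b
    using dist_exp_i_1[of "a - b"] by (simp add: norm_mult)
  moreover have "2 * \<bar>sin (c / 2)\<bar> \<le> \<bar>c\<bar>" for c :: real
    using abs_sin_x_le_abs_x[of "c / 2"] by simp
  ultimately have "norm (cis a - cis b) \<le> \<bar>a - b\<bar>" for a b
    by metis
  from this[of "2 * pi * s" "2 * pi * t"] show ?thesis
    by (simp add: circle_param_def dist_norm abs_mult flip: right_diff_distrib)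
qed

text \<open>Local inverse of the parametrization: the arc complementary to the parameters within
  \<eta> of \<open>s\<close> is compact and misses \<open>circle_param s\<close>, hence keeps a
  positive distance from it.\<close>

lemma near_circle_param:
  assumes "\<eta> > 0"
  obtains \<delta> where "\<delta> > 0"
    "\<And>y. y \<in> circle \<Longrightarrow> dist y (circle_param s) < \<delta> \<Longrightarrow> \<exists>t. \<bar>t - s\<bar> < \<eta> \<and> y = circle_param t"
proof -
  define K where "K = circle_param ` {s + \<eta>..s + 1 - \<eta>}"
  have "circle_param s \<notin> K"
  proof
    assume "circle_param s \<in> K"
    then obtain t where t: "s + \<eta> \<le> t" "t \<le> s + 1 - \<eta>" "circle_param t = circle_param s"
      unfolding K_def by force
    then obtain n :: int where "t = s + n"
      using circle_param_eq_iff by blast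
    then have "0 < n" "n < 1"
      using t assms by linarith+
    then show False by simp
  qed
  moreover have "closed K"
    unfolding K_def by (intro compact_imp_closed compact_continuous_image continuous_circle_param) auto
  ultimately obtain \<delta> where \<delta>: "\<delta> > 0" "\<And>y. y \<in> K \<Longrightarrow> \<delta> \<le> dist (circle_param s) y"
    using separate_point_closed[of K "circle_param s"] by auto
  have "\<exists>t. \<bar>t - s\<bar> < \<eta> \<and> y = circle_param t" if "y \<in> circle" "dist y (circle_param s) < \<delta>" for y
  proof -
    have "y \<notin> K"
      using that \<delta>(2)[of y] by (auto simp: dist_commute)
    obtain t where t: "s \<le> t" "t < s + 1" "y = circle_param t"
      using circle_param_surj[OF \<open>y \<in> circle\<close>] by metis
    have "\<not> (s + \<eta> \<le> t \<and> t \<le> s + 1 - \<eta>)"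
      using \<open>y \<notin> K\<close> t unfolding K_def by auto
    \<comment> \<open>A parameter outside the excluded range lies just right of \<open>s\<close> or
      just left of \<open>s + 1\<close>; in the second case \<open>t - 1\<close> is the one close to
      \<open>s\<close>.\<close>
    moreover have "y = circle_param (t - 1)"
      using circle_param_add_int[of t "-1"] t by simp
    ultimately show ?thesis
      using t assms by (intro exI[of _ "if t < s + \<eta> then t else t - 1"]) auto
  qed
  with \<delta>(1) that show ?thesis by blast
qed

text \<open>Gives the contradiction in two later arguments: a periodic lift would put the circle
  inside a countable set, an atom would make it finite.\<close>

lemma uncountable_circle: "uncountable circle"
proof
  assume "countable circle"
  moreover have "inj_on circle_param {0..<1}"
  proof (rule inj_onI)
    fix s t :: real assume st: "s \<in> {0..<1}" "t \<in> {0..<1}" "circle_param s = circle_param t"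
    then obtain n :: int where "s = t + n"
      using circle_param_eq_iff by blast
    with st have "n < 1" "n > -1" by auto
    with \<open>s = t + n\<close> show "s = t" by simp
  qed
  ultimately have "countable {0..<1::real}"
    by (metis circle_param_in_circle countable_subset image_subsetI countable_image_inj_on)
  then show False
    using uncountable_half_open_interval_1[of 0 1] by simp
qed

section \<open>Measurability, integration and determination of measures by continuous
  functions\<close>

lemma borel_measurable_circle:
  fixes f :: "complex \<Rightarrow> 'b::topological_space"
  assumes "sets \<mu> = sets circle_borel" "continuous_on circle f"
  shows "f \<in> borel_measurable \<mu>"
  using borel_measurable_continuous_on_restrict[OF assms(2)] assms(1)
  by (simp cong: measurable_cong_sets)

lemma space_circle_measure: "sets \<mu> = sets circle_borel \<Longrightarrow> space \<mu> = circle"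
  using sets_eq_imp_space_eq[of \<mu> circle_borel] by (simp add: space_restrict_space)

lemma closed_in_circle_borel: "closed S \<Longrightarrow> S \<subseteq> circle \<Longrightarrow> S \<in> sets circle_borel"
  by (auto simp: sets_restrict_space image_iff intro!: bexI[of _ S])

lemma ball_in_circle_borel: "ball x r \<inter> circle \<in> sets circle_borel"
  by (auto simp: sets_restrict_space)

lemma continuous_on_circle_bounded:
  fixes f :: "complex \<Rightarrow> real"
  assumes "continuous_on circle f"
  obtains B where "B > 0" "\<And>x. x \<in> circle \<Longrightarrow> \<bar>f x\<bar> \<le> B"
proof -
  have "bounded (f ` circle)"
    using assms by (intro compact_imp_bounded compact_continuous_image) auto
  then show ?thesis
    using that unfolding bounded_pos by auto
qed

lemma integrable_continuous_circle:
  fixes f :: "complex \<Rightarrow> real"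
  assumes "sets \<mu> = sets circle_borel" "finite_measure \<mu>" "continuous_on circle f"
  shows "integrable \<mu> f"
proof -
  obtain B where B: "\<And>x. x \<in> circle \<Longrightarrow> \<bar>f x\<bar> \<le> B"
    using continuous_on_circle_bounded[OF assms(3)] by metis
  show ?thesis
    using B assms(1) borel_measurable_circle[OF assms(1,3)]
    by (intro finite_measure.integrable_const_bound[OF assms(2), of _ B])
      (auto simp: space_circle_measure intro!: AE_I2)
qed

lemma continuous_maps_measurable:
  assumes "continuous_on circle h" "h ` circle \<subseteq> circle"
  shows "h \<in> circle_borel \<rightarrow>\<^sub>M circle_borel"
  using assms by (intro measurable_restrict_space2 borel_measurable_continuous_on_restrict)
      (auto simp: space_restrict_space)

text \<open>Closed sets form an intersection-stable generator whose indicators are limits of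
  continuous functions, as the Dynkin argument below requires.\<close>

lemma sigma_sets_closed_circle: "sets circle_borel = sigma_sets circle {S. closed S \<and> S \<subseteq> circle}"
proof -
  have "borel = sigma UNIV (Collect closed :: complex set set)"
    by (rule borel_eq_closed)
  then have "sets circle_borel = sets (restrict_space (sigma UNIV (Collect closed)) circle)"
    by (simp add: sets_restrict_space)
  also have "\<dots> = sigma_sets circle {circle \<inter> A | A. closed A}"
  proof -
    have "{circle \<inter> A | A. closed A} = (\<inter>) circle ` Collect closed"
      by auto
    then show ?thesis
      by (subst sets_restrict_space) (simp add: sigma_sets_Int)
  qed
  also have "{circle \<inter> A | A. closed A} = {S. closed S \<and> S \<subseteq> circle}"
    by (auto intro: exI[of _ "_ :: complex set"])
  finally show ?thesis .
qed

text \<open>Continuous functions decrease to the indicator of a closed set, and Dynkin's theorem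
  passes from closed to Borel sets. The form with a finite linear combination covers both the
  identity of a stationary measure with the average of its images and the equality of two
  measures.\<close>

lemma signed_measure_zero:
  fixes c :: "'i \<Rightarrow> real"
  assumes N: "\<And>i. i \<in> I \<Longrightarrow> sets (N i) = sets circle_borel" "\<And>i. i \<in> I \<Longrightarrow> finite_measure (N i)"
    and zero: "\<And>f :: complex \<Rightarrow> real. continuous_on circle f \<Longrightarrow> (\<Sum>i\<in>I. c i * (\<integral>x. f x \<partial>N i)) = 0"
    and A: "A \<in> sets circle_borel"
  shows "(\<Sum>i\<in>I. c i * measure (N i) A) = 0"
proof -
  have closed: "(\<Sum>i\<in>I. c i * measure (N i) S) = 0" if S: "closed S" "S \<subseteq> circle" for S
  \<comment> \<open>The empty set is split off because \<open>infdist x {}\<close> is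
    \<open>0\<close>, which would make the approximating functions constantly
    \<open>1\<close>.\<close>
  proof (cases "S = {}")
    case False
    \<comment> \<open>A tent function: \<open>1\<close> on \<open>S\<close> and, for positive
      \<open>n\<close>, \<open>0\<close> at distance at least \<open>1 / n\<close> from it.\<close>
    define u :: "nat \<Rightarrow> complex \<Rightarrow> real" where "u n x = max 0 (1 - real n * infdist x S)" for n x
    have cont: "continuous_on circle (u n)" for n
      unfolding u_def by (intro continuous_intros)
    have bound: "\<bar>u n x\<bar> \<le> 1" for n x
      unfolding u_def using infdist_nonneg[of x S] by auto
    have lim: "(\<lambda>n. u n x) \<longlonglongrightarrow> indicator S x" for x
    proof (cases "x \<in> S")
      case True
      then show ?thesis by (simp add: u_def)
    next
      case xS: False
      then have pos: "infdist x S > 0"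
        using S False by (simp add: infdist_pos_not_in_closed)
      obtain m :: nat where m: "1 < real m * infdist x S"
        using reals_Archimedean3[OF pos] by blast
      have "u n x = 0" if "n \<ge> m" for n
      proof -
        have "real m * infdist x S \<le> real n * infdist x S"
          using that pos by (intro mult_right_mono) auto
        with m show ?thesis by (simp add: u_def)
      qed
      then have "\<forall>\<^sub>F n in sequentially. u n x = 0"
        using eventually_sequentially by blast
      then show ?thesis
        using xS by (simp add: tendsto_eventually)
    qed
    have "(\<lambda>n. \<integral>x. u n x \<partial>N i) \<longlonglongrightarrow> (\<integral>x. indicator S x \<partial>N i)" if "i \<in> I" for i
    proof (rule integral_dominated_convergence[where w = "\<lambda>_. 1"])
      show "integrable (N i) (\<lambda>_. 1 :: real)"
        using finite_measure.integrable_const[OF N(2)[OF that]] .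
      show "(indicator S :: complex \<Rightarrow> real) \<in> borel_measurable (N i)"
        using closed_in_circle_borel[OF S] N(1)[OF that] by simp
      show "u n \<in> borel_measurable (N i)" for n
        by (rule borel_measurable_circle[OF N(1)[OF that] cont])
    qed (use bound lim in auto)
    moreover have "(\<integral>x. indicator S x \<partial>N i) = measure (N i) S" if "i \<in> I" for i
      using closed_in_circle_borel[OF S] N(1)[OF that] by (simp add: space_circle_measure Int_absorb2 S)
    ultimately have "(\<lambda>n. \<Sum>i\<in>I. c i * (\<integral>x. u n x \<partial>N i)) \<longlonglongrightarrow> (\<Sum>i\<in>I. c i * measure (N i) S)"
      by (intro tendsto_sum tendsto_mult tendsto_const) auto
    then have "(\<lambda>n::nat. 0) \<longlonglongrightarrow> (\<Sum>i\<in>I. c i * measure (N i) S)"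
      using zero[OF cont] by simp
    then show ?thesis
      using LIMSEQ_unique tendsto_const by metis
  qed simp
  have "Int_stable {S. closed S \<and> S \<subseteq> circle}"
    by (auto simp: Int_stable_def)
  moreover have "{S. closed S \<and> S \<subseteq> circle} \<subseteq> Pow circle"
    by blast
  moreover have "A \<in> sigma_sets circle {S. closed S \<and> S \<subseteq> circle}"
    using A sigma_sets_closed_circle by blast
  ultimately show ?thesis
  proof (induct rule: sigma_sets_induct_disjoint)
    case (compl B)
    then have B: "B \<in> sets circle_borel"
      using sigma_sets_closed_circle by blast
    have "measure (N i) (circle - B) = measure (N i) circle - measure (N i) B" if "i \<in> I" for i
      using finite_measure.finite_measure_compl[OF N(2)[OF that], of B] B N(1)[OF that]
      by (simp add: space_circle_measure)
    then have "(\<Sum>i\<in>I. c i * measure (N i) (circle - B)) =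
        (\<Sum>i\<in>I. c i * measure (N i) circle) - (\<Sum>i\<in>I. c i * measure (N i) B)"
      by (simp add: right_diff_distrib sum_subtractf)
    \<comment> \<open>The total mass of the combination vanishes since the circle is itself a closed
      set of the generator.\<close>
    then show ?case
      using compl closed[of circle] by simp
  next
    case (union B)
    then have "range B \<subseteq> sets circle_borel"
      using sigma_sets_closed_circle by blast
    then have "(\<lambda>n. measure (N i) (B n)) sums measure (N i) (\<Union>n. B n)" if "i \<in> I" for i
      using finite_measure.finite_measure_UNION[OF N(2)[OF that], of B] N(1)[OF that] union by simp
    then have "(\<lambda>n. \<Sum>i\<in>I. c i * measure (N i) (B n)) sums (\<Sum>i\<in>I. c i * measure (N i) (\<Union>n. B n))"
      by (intro sums_sum sums_mult) auto
    then have "(\<lambda>n. 0) sums (\<Sum>i\<in>I. c i * measure (N i) (\<Union>n. B n))"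
      by (simp only: union)
    then show ?case
      using sums_unique2[OF sums_zero] by metis
  qed (use closed in auto)
qed

section \<open>Existence of stationary measures\<close>

definition dual_op ::
  "nat \<Rightarrow> (nat \<Rightarrow> complex \<Rightarrow> complex) \<Rightarrow> (nat \<Rightarrow> real) \<Rightarrow> (complex \<Rightarrow> real) \<Rightarrow> complex \<Rightarrow> real" where
  "dual_op k g p f x = (\<Sum>i = 1..k. p i * f (g i x))"

text \<open>Neither invertibility nor orientation is required, so the same results apply to the
  system and to the system of inverse maps.\<close>

locale circle_ifs =
  fixes k :: nat and g :: "nat \<Rightarrow> complex \<Rightarrow> complex" and p :: "nat \<Rightarrow> real"
  assumes cont_g: "i \<in> {1..k} \<Longrightarrow> continuous_on circle (g i)"
    and g_in_circle: "i \<in> {1..k} \<Longrightarrow> x \<in> circle \<Longrightarrow> g i x \<in> circle"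
    and p_pos: "i \<in> {1..k} \<Longrightarrow> p i > 0"
    and p_sum: "(\<Sum>i = 1..k. p i) = 1"
begin

abbreviation "U \<equiv> dual_op k g p"

lemma continuous_on_U:
  assumes "continuous_on circle f"
  shows "continuous_on circle (U f)"
  unfolding dual_op_def
  by (intro continuous_on_sum continuous_on_mult continuous_on_const
      continuous_on_compose2[OF assms cont_g]) (use g_in_circle in auto)

lemma p_nonneg: "i \<in> {1..k} \<Longrightarrow> 0 \<le> p i"
  using p_pos by force

lemma abs_U_le:
  assumes "\<And>x. x \<in> circle \<Longrightarrow> \<bar>f x\<bar> \<le> B" "x \<in> circle"
  shows "\<bar>U f x\<bar> \<le> B"
proof -
  have "\<bar>U f x\<bar> \<le> (\<Sum>i = 1..k. \<bar>p i * f (g i x)\<bar>)"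
    unfolding dual_op_def by (rule sum_abs)
  also have "\<dots> \<le> (\<Sum>i = 1..k. p i * B)"
    using assms g_in_circle p_nonneg by (intro sum_mono) (auto simp: abs_mult intro!: mult_left_mono)
  also have "\<dots> = B"
    using p_sum by (simp flip: sum_distrib_right)
  finally show ?thesis .
qed

text \<open>Turns the weights into a law on indices, so that random compositions can be formed by
  monadic bind. The values of \<open>p\<close> off \<open>{1..k}\<close> are arbitrary and are
  replaced by zero.\<close>

lemma weight_pmf:
  obtains P :: "nat pmf" where "set_pmf P \<subseteq> {1..k}" "\<And>i. i \<in> {1..k} \<Longrightarrow> pmf P i = p i"
proof -
  define q where "q i = (if i \<in> {1..k} then p i else 0)" for i
  define P where "P = embed_pmf q"
  have q: "0 \<le> q i" for i
    using p_nonneg by (simp add: q_def)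
  have "(\<integral>\<^sup>+i. ennreal (q i) \<partial>count_space UNIV) = (\<Sum>i = 1..k. ennreal (q i))"
    by (intro nn_integral_count_space') (auto simp: q_def)
  also have "\<dots> = ennreal (\<Sum>i = 1..k. q i)"
    using q by (simp add: sum_ennreal)
  also have "\<dots> = 1"
    using p_sum by (simp add: q_def)
  finally have tot: "(\<integral>\<^sup>+i. ennreal (q i) \<partial>count_space UNIV) = 1" .
  have P: "pmf P i = q i" "set_pmf P = {i. q i \<noteq> 0}" for i
    unfolding P_def using q tot by (simp_all add: pmf_embed_pmf set_embed_pmf)
  then have "set_pmf P \<subseteq> {1..k}"
    by (auto simp: q_def split: if_splits)
  then show ?thesis
    using that[of P] P(1) by (simp add: q_def)
qed

text \<open>The averaging of Krylov and Bogolyubov: \<open>Q n\<close> is the law of the random walk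
  from the point \<open>1\<close> at a time uniform in \<open>{..n}\<close>. The invariance defect
  telescopes to two boundary terms, hence is at most \<open>2 * B / real (Suc n)\<close>. Finite
  supports turn all expectations into finite sums.\<close>

lemma cesaro_pmfs:
  obtains Q :: "nat \<Rightarrow> complex pmf" where
    "\<And>n. set_pmf (Q n) \<subseteq> circle"
    "\<And>f. continuous_on circle f \<Longrightarrow>
      (\<lambda>n. measure_pmf.expectation (Q n) (U f) - measure_pmf.expectation (Q n) f) \<longlonglongrightarrow> 0"
proof -
  obtain P where setP: "set_pmf P \<subseteq> {1..k}" and P: "\<And>i. i \<in> {1..k} \<Longrightarrow> pmf P i = p i"
    using weight_pmf by blast
  define K where "K x = map_pmf (\<lambda>i. g i x) P" for x
  have K: "measure_pmf.expectation (K x) f = U f x" for x f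
  proof -
    have "measure_pmf.expectation (K x) f = (\<Sum>i = 1..k. f (g i x) * pmf P i)"
      unfolding K_def integral_map_pmf
      by (intro integral_measure_pmf_real) (use setP in auto)
    then show ?thesis
      by (simp add: P dual_op_def mult.commute)
  qed
  have finK: "finite (set_pmf (K x))" for x
    using finite_subset[OF setP] by (simp add: K_def)
  define X where "X = rec_nat (return_pmf 1) (\<lambda>_ m. bind_pmf m K)"
  have X0: "X 0 = return_pmf 1" and XS: "X (Suc n) = bind_pmf (X n) K" for n
    by (simp_all add: X_def)
  have finX: "finite (set_pmf (X n))" for n
    by (induction n) (auto simp: X0 XS finK)
  have circX: "set_pmf (X n) \<subseteq> circle" for n
  proof (induction n)
    case (Suc n)
    show ?case
    proof
      fix y assume "y \<in> set_pmf (X (Suc n))"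
      then obtain x i where "x \<in> set_pmf (X n)" "i \<in> set_pmf P" "y = g i x"
        by (auto simp: XS K_def)
      then show "y \<in> circle"
        using Suc setP g_in_circle by blast
    qed
  qed (simp add: X0)
  have EX: "measure_pmf.expectation (X (Suc n)) f = measure_pmf.expectation (X n) (U f)" for n f
  proof -
    have "measure_pmf.expectation (X (Suc n)) f =
        (\<Sum>a\<in>set_pmf (X n). pmf (X n) a *\<^sub>R measure_pmf.expectation (K a) f)"
      unfolding XS by (intro pmf_expectation_bind) (auto simp: finX finK)
    also have "\<dots> = measure_pmf.expectation (X n) (U f)"
      unfolding K by (subst integral_measure_pmf[of "set_pmf (X n)"]) (auto simp: finX)
    finally show ?thesis .
  qed
  define Q where "Q n = pmf_of_set {..n} \<bind> X" for n
  have Q: "measure_pmf.expectation (Q n) f =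
      (\<Sum>j\<le>n. measure_pmf.expectation (X j) f) / real (Suc n)" for n and f :: "complex \<Rightarrow> real"
  proof -
    have "measure_pmf.expectation (Q n) f = (\<Sum>j\<le>n. measure_pmf.expectation (X j) f /\<^sub>R real (card {..n}))"
      unfolding Q_def by (intro pmf_expectation_bind_pmf_of_set) (auto simp: finX)
    also have "\<dots> = (\<Sum>j\<le>n. measure_pmf.expectation (X j) f / real (Suc n))"
      by (intro sum.cong refl) (simp add: divide_inverse)
    finally show ?thesis
      by (simp only: sum_divide_distrib)
  qed
  have "(\<lambda>n. measure_pmf.expectation (Q n) (U f) - measure_pmf.expectation (Q n) f) \<longlonglongrightarrow> 0"
    if f: "continuous_on circle f" for f
  proof -
    obtain B where B: "\<And>x. x \<in> circle \<Longrightarrow> \<bar>f x\<bar> \<le> B"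
      using continuous_on_circle_bounded[OF f] by metis
    have XB: "\<bar>measure_pmf.expectation (X n) f\<bar> \<le> B" for n
    proof -
      have "\<bar>measure_pmf.expectation (X n) f\<bar> \<le> measure_pmf.expectation (X n) (\<lambda>x. \<bar>f x\<bar>)"
        by (rule integral_abs_bound)
      also have "\<dots> \<le> measure_pmf.expectation (X n) (\<lambda>x. B)"
      proof (rule integral_mono_AE)
        show "AE x in measure_pmf (X n). \<bar>f x\<bar> \<le> B"
          unfolding AE_measure_pmf_iff using B circX by blast
      qed (simp_all add: integrable_measure_pmf_finite finX)
      finally show ?thesis by simp
    qed
    have bound: "\<bar>measure_pmf.expectation (Q n) (U f) - measure_pmf.expectation (Q n) f\<bar> \<le>
        2 * B / real (Suc n)" for n
    proof -
      have "measure_pmf.expectation (Q n) (U f) - measure_pmf.expectation (Q n) f =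
          (\<Sum>j\<le>n. measure_pmf.expectation (X (Suc j)) f - measure_pmf.expectation (X j) f) / real (Suc n)"
        by (simp only: Q EX sum_subtractf diff_divide_distrib)
      also have "(\<Sum>j\<le>n. measure_pmf.expectation (X (Suc j)) f - measure_pmf.expectation (X j) f) =
          measure_pmf.expectation (X (Suc n)) f - measure_pmf.expectation (X 0) f"
        by (induction n) simp_all
      finally have "\<bar>measure_pmf.expectation (Q n) (U f) - measure_pmf.expectation (Q n) f\<bar> =
          \<bar>measure_pmf.expectation (X (Suc n)) f - measure_pmf.expectation (X 0) f\<bar> / real (Suc n)"
        by simp
      also have "\<dots> \<le> 2 * B / real (Suc n)"
        using XB[of "Suc n"] XB[of 0] by (intro divide_right_mono) linarith+
      finally show ?thesis .
    qed
    have "(\<lambda>n. 2 * B / real (Suc n)) \<longlonglongrightarrow> 0"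
      by (rule LIMSEQ_Suc[OF lim_const_over_n])
    then show ?thesis
    proof (rule Lim_null_comparison[rotated])
      show "\<forall>\<^sub>F n in sequentially.
          norm (measure_pmf.expectation (Q n) (U f) - measure_pmf.expectation (Q n) f) \<le> 2 * B / real (Suc n)"
        unfolding real_norm_def using bound by (intro always_eventually allI)
    qed
  qed
  moreover have "set_pmf (Q n) \<subseteq> circle" for n
    using circX by (auto simp: Q_def)
  ultimately show ?thesis
    using that by blast
qed

lemma integral_U:
  assumes "sets \<mu> = sets circle_borel" "finite_measure \<mu>" "continuous_on circle f"
  shows "(\<integral>x. U f x \<partial>\<mu>) = (\<Sum>i = 1..k. p i * (\<integral>x. f (g i x) \<partial>\<mu>))"
proof -
  have "continuous_on circle (\<lambda>x. f (g i x))" if "i \<in> {1..k}" for i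
    using g_in_circle[OF that] by (intro continuous_on_compose2[OF assms(3) cont_g[OF that]]) auto
  then have "integrable \<mu> (\<lambda>x. f (g i x))" if "i \<in> {1..k}" for i
    using integrable_continuous_circle[OF assms(1,2)] that by blast
  then show ?thesis
    unfolding dual_op_def by (subst Bochner_Integration.integral_sum) auto
qed

lemma g_measurable: "i \<in> {1..k} \<Longrightarrow> g i \<in> circle_borel \<rightarrow>\<^sub>M circle_borel"
  using g_in_circle by (intro continuous_maps_measurable cont_g) auto

text \<open>Passes from test functions to sets by applying \<open>signed_measure_zero\<close> to the
  weighted images of \<mu> minus \<mu>; index \<open>0\<close> carries \<mu> with coefficient
  \<open>- 1\<close>.\<close>

lemma invariant_measure_of_sets:
  assumes \<mu>: "sets \<mu> = sets circle_borel" "prob_space \<mu>"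
    and inv: "\<And>f. continuous_on circle f \<Longrightarrow> (\<integral>x. U f x \<partial>\<mu>) = (\<integral>x. f x \<partial>\<mu>)"
    and A: "A \<in> sets circle_borel"
  shows "measure \<mu> A = (\<Sum>i = 1..k. p i * measure \<mu> (g i -` A \<inter> circle))"
proof -
  interpret prob_space \<mu> by fact
  define N where "N i = (if i = 0 then \<mu> else distr \<mu> circle_borel (g i))" for i
  define c where "c i = (if i = 0 then - 1 else p i)" for i
  have split: "(\<Sum>i\<in>{0..k}. c i * F (N i)) = - F \<mu> + (\<Sum>i = 1..k. p i * F (distr \<mu> circle_borel (g i)))"
    for F :: "complex measure \<Rightarrow> real"
    by (subst sum.atLeast_Suc_atMost) (auto simp: c_def N_def intro!: sum.cong)
  have meas: "g i \<in> \<mu> \<rightarrow>\<^sub>M circle_borel" if "i \<in> {1..k}" for i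
    using g_measurable[OF that] \<mu>(1) by (simp cong: measurable_cong_sets)
  have "(\<Sum>i\<in>{0..k}. c i * measure (N i) A) = 0"
  proof (rule signed_measure_zero[OF _ _ _ A])
    show "sets (N i) = sets circle_borel" for i
      by (simp add: N_def \<mu>)
    show "finite_measure (N i)" if "i \<in> {0..k}" for i
      using that meas by (auto simp: N_def finite_measure_axioms intro!: finite_measure_distr)
    show "(\<Sum>i\<in>{0..k}. c i * (\<integral>x. f x \<partial>N i)) = 0" if f: "continuous_on circle f" for f :: "complex \<Rightarrow> real"
    proof -
      have "(\<integral>x. f x \<partial>distr \<mu> circle_borel (g i)) = (\<integral>x. f (g i x) \<partial>\<mu>)" if "i \<in> {1..k}" for i
        by (intro integral_distr meas that borel_measurable_circle[OF refl f])
      then have "(\<Sum>i = 1..k. p i * (\<integral>x. f x \<partial>distr \<mu> circle_borel (g i))) = (\<integral>x. f x \<partial>\<mu>)"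
        using integral_U[OF \<mu>(1) finite_measure_axioms f] inv[OF f] by simp
      then show ?thesis
        unfolding split[of "\<lambda>M. \<integral>x. f x \<partial>M"] by simp
    qed
  qed
  moreover have "measure (distr \<mu> circle_borel (g i)) A = measure \<mu> (g i -` A \<inter> circle)" if "i \<in> {1..k}" for i
    using measure_distr[OF meas[OF that] A] space_circle_measure[OF \<mu>(1)] by simp
  ultimately show ?thesis
    unfolding split[of "\<lambda>M. measure M A"] by simp
qed

text \<open>A weak limit of the averages \<open>Q n\<close> has no invariance defect. Compactness is
  borrowed from tight sequences of distributions on the real line: the averages are moved to
  \<open>[0, 1)\<close> and the limit is pushed back by \<open>circle_param\<close>.\<close>

lemma exists_invariant:
  obtains \<mu> where "sets \<mu> = sets circle_borel" "prob_space \<mu>"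
    "\<And>f. continuous_on circle f \<Longrightarrow> (\<integral>x. U f x \<partial>\<mu>) = (\<integral>x. f x \<partial>\<mu>)"
proof -
  obtain Q :: "nat \<Rightarrow> complex pmf" where Q: "\<And>n. set_pmf (Q n) \<subseteq> circle"
    and Qlim: "\<And>f. continuous_on circle f \<Longrightarrow>
      (\<lambda>n. measure_pmf.expectation (Q n) (U f) - measure_pmf.expectation (Q n) f) \<longlonglongrightarrow> 0"
    using cesaro_pmfs by blast
  have "\<exists>t. 0 \<le> t \<and> t < 1 \<and> (z \<in> circle \<longrightarrow> z = circle_param t)" for z
  proof (cases "z \<in> circle")
    case True
    then obtain t where "0 \<le> t" "t < 0 + 1" "z = circle_param t"
      by (rule circle_param_surj)
    then show ?thesis by auto
  next
    case False
    then show ?thesis by (intro exI[of _ 0]) simp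
  qed
  \<comment> \<open>No regularity of this section is asked for: every function is measurable for a
    discrete law.\<close>
  then obtain \<theta> where \<theta>: "\<And>z. 0 \<le> \<theta> z" "\<And>z. \<theta> z < 1" "\<And>z. z \<in> circle \<Longrightarrow> circle_param (\<theta> z) = z"
    by metis
  define M where "M n = distr (measure_pmf (Q n)) borel \<theta>" for n
  have M: "real_distribution (M n)" for n
    unfolding M_def by (intro prob_space.real_distribution_distr prob_space_measure_pmf) simp
  have M_int: "measure (M n) {-1<..1} = 1" for n
  proof -
    have "\<theta> -` {-1<..1} = UNIV"
      using \<theta>(1,2) by (fastforce intro: less_imp_le less_le_trans[of _ 0])
    then show ?thesis
      unfolding M_def by (subst measure_distr) auto
  qed
  \<comment> \<open>Tightness uses intervals open on the left, so the left end \<open>-1\<close>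
    leaves room for the value \<open>0\<close> of \<theta>.\<close>
  have "\<exists>a b. a < b \<and> (\<forall>n. measure (M n) {a<..b} > 1 - \<epsilon>)" if "\<epsilon> > 0" for \<epsilon> :: real
    by (rule exI[of _ "-1"], rule exI[of _ 1]) (use that M_int in auto)
  then have "tight M"
    unfolding tight_def using M by blast
  then obtain r L where r: "strict_mono (r :: nat \<Rightarrow> nat)" and L: "real_distribution L"
    and w: "weak_conv_m (M \<circ> id \<circ> r) L"
    using tight_imp_convergent_subsubsequence[of M id] by (auto simp: strict_mono_id)
  define \<mu> where "\<mu> = distr L circle_borel circle_param"
  interpret L: real_distribution L by fact
  have cp: "circle_param \<in> L \<rightarrow>\<^sub>M circle_borel"
    by (intro measurable_restrict_space2)
      (auto intro!: borel_measurable_continuous_onI continuous_circle_param simp: measurable_cong_sets[OF L.events_eq_borel refl])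
  have conv: "(\<lambda>n. measure_pmf.expectation (Q (r n)) f) \<longlonglongrightarrow> (\<integral>x. f x \<partial>\<mu>)"
    if f: "continuous_on circle f" for f :: "complex \<Rightarrow> real"
  proof -
    obtain B where B: "\<And>x. x \<in> circle \<Longrightarrow> \<bar>f x\<bar> \<le> B"
      using continuous_on_circle_bounded[OF f] by metis
    \<comment> \<open>Periodicity makes the test function continuous across integers, so mass
      drifting to the parameter \<open>1\<close> is still counted at the right point of the
      circle.\<close>
    have cont: "continuous_on UNIV (\<lambda>t. f (circle_param t))"
      by (intro continuous_on_compose2[OF f continuous_circle_param]) auto
    then have "isCont (\<lambda>t. f (circle_param t)) t" for t
      by (simp add: continuous_on_eq_continuous_at)
    then have "(\<lambda>n. \<integral>t. f (circle_param t) \<partial>(M \<circ> id \<circ> r) n) \<longlonglongrightarrow> (\<integral>t. f (circle_param t) \<partial>L)"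
      using M B by (intro weak_conv_imp_integral_bdd_continuous_conv[OF _ L w, of _ B]) auto
    moreover have "(\<integral>t. f (circle_param t) \<partial>M n) = measure_pmf.expectation (Q n) f" for n
    proof -
      have "(\<integral>t. f (circle_param t) \<partial>M n) = measure_pmf.expectation (Q n) (\<lambda>z. f (circle_param (\<theta> z)))"
        unfolding M_def by (intro integral_distr borel_measurable_continuous_onI cont) simp
      also have "\<dots> = measure_pmf.expectation (Q n) f"
        using Q[of n] \<theta>(3) by (intro integral_cong_AE) (auto simp: AE_measure_pmf_iff)
      finally show ?thesis .
    qed
    moreover have "(\<integral>x. f x \<partial>\<mu>) = (\<integral>t. f (circle_param t) \<partial>L)"
      unfolding \<mu>_def by (intro integral_distr cp borel_measurable_circle[OF refl f])
    ultimately show ?thesis by simp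
  qed
  have "(\<integral>x. U f x \<partial>\<mu>) = (\<integral>x. f x \<partial>\<mu>)" if f: "continuous_on circle f" for f
  proof -
    have "(\<lambda>n. measure_pmf.expectation (Q (r n)) (U f) - measure_pmf.expectation (Q (r n)) f)
        \<longlonglongrightarrow> (\<integral>x. U f x \<partial>\<mu>) - (\<integral>x. f x \<partial>\<mu>)"
      by (intro tendsto_diff conv f continuous_on_U)
    moreover have "(\<lambda>n. measure_pmf.expectation (Q (r n)) (U f) - measure_pmf.expectation (Q (r n)) f) \<longlonglongrightarrow> 0"
      using LIMSEQ_subseq_LIMSEQ[OF Qlim[OF f] r] by (simp add: comp_def)
    ultimately show ?thesis
      using LIMSEQ_unique by fastforce
  qed
  moreover have "prob_space \<mu>"
    unfolding \<mu>_def by (intro L.prob_space_distr cp)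
  moreover have "sets \<mu> = sets circle_borel"
    by (simp add: \<mu>_def)
  ultimately show ?thesis
    using that by blast
qed

end

section \<open>Minimality of a homeomorphism with a dense orbit\<close>

lemma homeo_plus_lift:
  assumes "f \<in> homeo_plus"
  obtains F where "continuous_on UNIV F" "strict_mono F"
    "\<And>t n. F (t + of_int n) = F t + of_int n" "\<And>t. f (circle_param t) = circle_param (F t)"
proof -
  obtain F :: "real \<Rightarrow> real" where F: "continuous_on UNIV F" "strict_mono F" "\<And>t. F (t + 1) = F t + 1"
    "\<And>t. f (circle_param t) = circle_param (F t)"
    using assms unfolding homeo_plus_def by blast
  have nat: "F (t + real n) = F t + real n" for t n
  proof (induction n)
    case (Suc n)
    then show ?case
      using F(3)[of "t + real n"] by (simp add: algebra_simps)
  qed simp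
  have "F (t + of_int n) = F t + of_int n" for t n
  proof (cases "n \<ge> 0")
    case True
    then show ?thesis
      using nat[of t "nat n"] by simp
  next
    case False
    then show ?thesis
      using nat[of "t + of_int n" "nat (- n)"] by simp
  qed
  with F that show ?thesis by blast
qed

lemma continuous_on_funpow:
  assumes "continuous_on S f" "f ` S \<subseteq> S"
  shows "continuous_on S (f ^^ n)" "(f ^^ n) ` S \<subseteq> S"
proof (induction n)
  case (Suc n)
  {
    case 1
    show ?case
      unfolding funpow.simps
      by (intro continuous_on_compose Suc.IH continuous_on_subset[OF assms(1)])
  next
    case 2
    show ?case
      using Suc.IH(2) assms(2) by auto
  }
qed (simp_all add: continuous_on_id')

text \<open>The first step decides the direction of the whole orbit, and the fixed points
  \<open>a\<close> and \<open>b\<close> confine it.\<close>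

lemma monotone_iterates_converge:
  fixes H :: "real \<Rightarrow> real"
  assumes "mono H" "H a = a" "H b = b" "a \<le> t" "t \<le> b"
  obtains l where "(\<lambda>q. (H ^^ q) t) \<longlonglongrightarrow> l"
proof -
  have mono: "mono (H ^^ q)" for q
    using assms(1) by (rule mono_pow)
  have fixed: "(H ^^ q) a = a" "(H ^^ q) b = b" for q
    by (induction q) (simp_all add: assms)
  have "monoseq (\<lambda>q. (H ^^ q) t)"
  proof (cases "t \<le> H t")
    case True
    have "(H ^^ q) t \<le> (H ^^ Suc q) t" for q
      using monoD[OF mono True, of q] by (simp add: funpow_swap1)
    then show ?thesis
      by (simp add: incseq_SucI monoseq_iff)
  next
    case False
    have "(H ^^ Suc q) t \<le> (H ^^ q) t" for q
      using monoD[OF mono, of "H t" t q] False by (simp add: funpow_swap1)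
    then show ?thesis
      by (simp add: decseq_SucI monoseq_iff)
  qed
  moreover have "\<bar>(H ^^ q) t\<bar> \<le> max \<bar>a\<bar> \<bar>b\<bar>" for q
    using monoD[OF mono assms(4), of q] monoD[OF mono assms(5), of q] unfolding fixed by linarith
  ultimately show ?thesis
    using monoseq_convergent that by blast
qed

text \<open>
  If the lift has a fixed point modulo integers, every forward orbit splits into finitely many
  convergent sequences and so has a countable closure.
\<close>

lemma dense_orbit_no_periodic_lift:
  fixes F :: "real \<Rightarrow> real"
  assumes F: "strict_mono F" "\<And>t n. F (t + of_int n) = F t + of_int n"
      "\<And>t. f (circle_param t) = circle_param (F t)"
    and x: "x \<in> circle" and dense: "circle \<subseteq> closure {(f ^^ n) x | n. n \<ge> 1}" and n: "n \<ge> 1"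
  shows "(F ^^ n) s + of_int j \<noteq> s"
proof
  assume s: "(F ^^ n) s + of_int j = s"
  obtain t0 where t0: "x = circle_param t0"
    using circle_param_surj[OF x] by metis
  have Fn: "(F ^^ m) (t + of_int i) = (F ^^ m) t + of_int i" for m t i
    by (induction m) (simp_all add: F)
  have fn: "(f ^^ m) (circle_param t) = circle_param ((F ^^ m) t)" for m t
    by (induction m) (simp_all add: F)
  \<comment> \<open>The integer shift makes \<open>s\<close> a true fixed point; the translates of
    \<open>s\<close> by integers are then fixed as well and trap every real orbit.\<close>
  define H where "H t = (F ^^ n) t + of_int j" for t
  have "mono F"
    using F(1) by (rule strict_mono_mono)
  then have "mono H"
    using mono_pow[of F n] by (auto simp: H_def mono_def)
  have H_int: "H (t + of_int i) = H t + of_int i" for t i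
    by (simp add: H_def Fn)
  have Hs: "H (s + of_int i) = s + of_int i" for i
    using s H_int[of s i] by (simp add: H_def)
  have Hq: "(H ^^ q) t = (F ^^ (q * n)) t + of_int (int q * j)" for q t
  proof (induction q)
    case (Suc q)
    have "(H ^^ Suc q) t = (F ^^ n) ((F ^^ (q * n)) t + of_int (int q * j)) + of_int j"
      by (simp add: Suc H_def)
    also have "\<dots> = (F ^^ n) ((F ^^ (q * n)) t) + of_int (int (Suc q) * j)"
      unfolding Fn by (simp add: algebra_simps)
    also have "(F ^^ n) ((F ^^ (q * n)) t) = (F ^^ (Suc q * n)) t"
      by (simp add: funpow_add)
    finally show ?case .
  qed simp
  have "\<exists>l. (\<lambda>q. (H ^^ q) t) \<longlonglongrightarrow> l" for t
  proof -
    have "s + of_int \<lfloor>t - s\<rfloor> \<le> t" "t \<le> s + of_int (\<lfloor>t - s\<rfloor> + 1)"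
      by linarith+
    then show ?thesis
      using monotone_iterates_converge[OF \<open>mono H\<close> Hs Hs] by metis
  qed
  then obtain l where l: "\<And>t. (\<lambda>q. (H ^^ q) t) \<longlonglongrightarrow> l t"
    by metis
  \<comment> \<open>The orbit of \<open>x\<close> along the times congruent to \<open>r\<close>
    modulo \<open>n\<close>, together with its limit: a compact countable set.\<close>
  define K where "K r = insert (circle_param (l ((F ^^ r) t0)))
      (range (\<lambda>q. circle_param ((H ^^ q) ((F ^^ r) t0))))" for r
  have "compact (K r)" for r
    unfolding K_def
    using continuous_on_tendsto_compose[OF continuous_circle_param[of UNIV] l]
    by (intro compact_sequence_with_limit) auto
  then have "closed (\<Union>r<n. K r)"
    by (intro closed_UN) (auto intro: compact_imp_closed)
  moreover have "(f ^^ m) x \<in> (\<Union>r<n. K r)" for m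
  proof -
    have "(F ^^ m) t0 = (F ^^ (m div n * n)) ((F ^^ (m mod n)) t0)"
      by (simp flip: comp_apply[of "F ^^ _"] funpow_add)
    then have "circle_param ((F ^^ m) t0) = circle_param ((H ^^ (m div n)) ((F ^^ (m mod n)) t0))"
      unfolding Hq circle_param_add_int by simp
    moreover have "m mod n < n"
      using n by simp
    ultimately show ?thesis
      unfolding t0 fn K_def by blast
  qed
  ultimately have "closure {(f ^^ n) x | n. n \<ge> 1} \<subseteq> (\<Union>r<n. K r)"
    by (intro closure_minimal) auto
  with dense have "circle \<subseteq> (\<Union>r<n. K r)"
    by order
  moreover have "countable (\<Union>r<n. K r)"
    by (auto simp: K_def)
  ultimately show False
    using uncountable_circle countable_subset by blast
qed

text \<open>If \<open>x\<close> is not in \<open>S\<close>, let \<open>b\<close> be the first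
  parameter of \<open>S\<close> to the right of \<open>t0\<close>. Some iterate of \<open>x\<close>
  lands just left of \<open>t0\<close>. The corresponding lift \<open>H\<close> moves
  \<open>t0\<close> to the left, but cannot move \<open>b\<close> to the left, because it would have
  to enter the gap of \<open>S\<close> around \<open>t0\<close>. So \<open>H\<close> has a fixed
  point between them, against \<open>dense_orbit_no_periodic_lift\<close>.\<close>

lemma dense_orbit_minimal:
  assumes f: "f \<in> homeo_plus"
    and x: "x \<in> circle" and dense: "circle \<subseteq> closure {(f ^^ n) x | n. n \<ge> 1}"
    and S: "closed S" "S \<noteq> {}" "S \<subseteq> circle" "f ` S \<subseteq> S"
  shows "S = circle"
proof (cases "x \<in> S")
  case True
  have "(f ^^ n) x \<in> S" for n
    by (induction n) (use True S in auto)
  then have "closure {(f ^^ n) x | n. n \<ge> 1} \<subseteq> S"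
    using S by (intro closure_minimal) auto
  with dense S show ?thesis by blast
next
  case False
  obtain F where F: "continuous_on UNIV F" "strict_mono F"
    "\<And>t n. F (t + of_int n) = F t + of_int n" "\<And>t. f (circle_param t) = circle_param (F t)"
    using homeo_plus_lift[OF f] by metis
  have fn: "(f ^^ m) (circle_param t) = circle_param ((F ^^ m) t)" for m t
    by (induction m) (simp_all add: F)
  have Fcont: "continuous_on UNIV (F ^^ m)" for m
    using continuous_on_funpow(1)[OF F(1)] by simp
  have Fmono: "strict_mono (F ^^ m)" for m
  proof (induction m)
    case (Suc m)
    show ?case
      using strict_mono_compose[OF F(2) Suc] by (simp add: comp_def)
  qed (simp add: strict_mono_def)
  define T where "T = circle_param -` S"
  have "closed T"
    unfolding T_def using S(1) by (intro closed_vimage continuous_circle_param)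
  obtain t0 where t0: "x = circle_param t0"
    using circle_param_surj[OF x] by metis
  then have "t0 \<notin> T"
    using False by (simp add: T_def)
  then obtain e where e: "e > 0" "\<And>t. \<bar>t - t0\<bar> < e \<Longrightarrow> t \<notin> T"
  proof -
    have "open (- T)" "t0 \<in> - T"
      using \<open>closed T\<close> \<open>t0 \<notin> T\<close> by auto
    then show ?thesis
      using that unfolding open_dist dist_real_def by blast
  qed
  obtain z where "z \<in> S"
    using S by blast
  then have "z \<in> circle"
    using S by blast
  then obtain t1 where "t0 \<le> t1" "t1 < t0 + 1" "z = circle_param t1"
    by (rule circle_param_surj)
  with \<open>z \<in> S\<close> have t1: "t0 \<le> t1" "t1 \<in> T"
    by (auto simp: T_def)
  define b where "b = Inf (T \<inter> {t0..})"
  have bdd: "bdd_below (T \<inter> {t0..})"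
    by (auto intro: bdd_belowI)
  have "b \<in> T \<inter> {t0..}"
    unfolding b_def using t1 \<open>closed T\<close> bdd by (intro closed_contains_Inf) auto
  then have b: "b \<in> T" "t0 \<le> b"
    by auto
  \<comment> \<open>The gap of radius \<open>e\<close> extends the minimality of \<open>b\<close> to
    parameters slightly left of \<open>t0\<close>.\<close>
  have b_least: "b \<le> t" if "t \<in> T" "t0 - e < t" for t
  proof (cases "t0 \<le> t")
    case True
    then show ?thesis
      unfolding b_def using bdd that by (intro cInf_lower) auto
  next
    case False
    then have "t \<notin> T"
      using that(2) by (intro e(2)) auto
    then show ?thesis using that by blast
  qed
  \<comment> \<open>Radius \<open>e / 2\<close> around \<open>t0 - e / 2\<close> gives exactly the
    parameters strictly between \<open>t0 - e\<close> and \<open>t0\<close>.\<close>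
  obtain \<delta> where \<delta>: "\<delta> > 0" "\<And>y. y \<in> circle \<Longrightarrow> dist y (circle_param (t0 - e / 2)) < \<delta> \<Longrightarrow>
      \<exists>t. \<bar>t - (t0 - e / 2)\<bar> < e / 2 \<and> y = circle_param t"
    using near_circle_param[of "e / 2" "t0 - e / 2"] e(1) by auto
  have "circle_param (t0 - e / 2) \<in> closure {(f ^^ n) x | n. n \<ge> 1}"
    using dense circle_param_in_circle by blast
  then obtain n where n: "n \<ge> 1" "dist ((f ^^ n) x) (circle_param (t0 - e / 2)) < \<delta>"
    unfolding closure_approachable using \<delta>(1) by blast
  then obtain t where t: "\<bar>t - (t0 - e / 2)\<bar> < e / 2" "(f ^^ n) x = circle_param t"
    using \<delta>(2)[of "(f ^^ n) x"] by (auto simp: t0 fn)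
  then obtain j :: int where j: "t = (F ^^ n) t0 + j"
    unfolding t0 fn by (metis circle_param_eq_iff)
  define H where "H s = (F ^^ n) s + of_int j" for s
  have Ht0: "t0 - e < H t0" "H t0 < t0"
    using t(1) j by (auto simp: H_def abs_less_iff field_simps)
  have "(F ^^ m) s \<in> T" if "s \<in> T" for m s
    by (induction m) (use that S(4) F(4) in \<open>auto simp: T_def\<close>)
  then have "H b \<in> T"
    using b by (simp add: H_def T_def)
  moreover have "H t0 \<le> H b"
    using strict_mono_less_eq[OF Fmono] b(2) by (simp add: H_def)
  ultimately have "b \<le> H b"
    using Ht0 by (intro b_least) auto
  \<comment> \<open>The displacement \<open>H s - s\<close> is negative at \<open>t0\<close> and
    nonnegative at \<open>b\<close>.\<close>
  then have "\<exists>s. t0 \<le> s \<and> s \<le> b \<and> H s - s = 0"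
    using Ht0 b(2) unfolding H_def
    by (intro IVT') (auto intro!: continuous_intros continuous_on_subset[OF Fcont])
  then show ?thesis
    using dense_orbit_no_periodic_lift[OF F(2-4) x dense n(1)] by (auto simp: H_def)
qed

text \<open>The points whose orbit avoids the ball up to time \<open>N\<close> form decreasing
  compact sets. Were all of them nonempty, their intersection would be closed and forward invariant,
  hence the whole circle by minimality, although it misses \<open>z\<close>.\<close>

lemma dense_orbit_uniform_return:
  assumes f: "f \<in> homeo_plus"
    and x: "x \<in> circle" and dense: "circle \<subseteq> closure {(f ^^ n) x | n. n \<ge> 1}"
    and z: "z \<in> circle" and r: "r > 0"
  obtains N where "\<And>y. y \<in> circle \<Longrightarrow> \<exists>n\<le>N. (f ^^ n) y \<in> ball z r"
proof -
  have f_cont: "continuous_on circle f" and f_im: "f ` circle = circle"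
    using f by (auto simp: homeo_plus_def homeomorphism_def)
  have fn_cont: "continuous_on circle (f ^^ n)" for n
    using f_im by (intro continuous_on_funpow(1) f_cont) simp
  define S where "S N = {y \<in> circle. \<forall>n\<le>N. (f ^^ n) y \<notin> ball z r}" for N
  have "\<exists>N. S N = {}"
  proof (rule ccontr)
    assume ne: "\<nexists>N. S N = {}"
    have "S N = (\<Inter>n\<le>N. circle \<inter> (f ^^ n) -` (- ball z r))" for N
      by (auto simp: S_def)
    moreover have "closed (\<Inter>n\<le>N. circle \<inter> (f ^^ n) -` (- ball z r))" for N
      by (intro closed_INT ballI continuous_closed_preimage fn_cont) auto
    ultimately have closed: "closed (S N)" for N
      by simp
    moreover have "bounded (S N)" for N
      by (rule bounded_subset[OF bounded_sphere[of 0 1]]) (auto simp: S_def)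
    ultimately have "compact (S N)" for N
      by (simp add: compact_eq_bounded_closed)
    then have "\<Inter> (range S) \<noteq> {}"
      using ne by (intro compact_nest) (auto simp: S_def)
    moreover have "f ` \<Inter> (range S) \<subseteq> \<Inter> (range S)"
    proof clarify
      fix y N assume y: "y \<in> \<Inter> (range S)"
      then have y: "y \<in> S (Suc N)"
        by blast
      have "(f ^^ n) (f y) \<notin> ball z r" if "n \<le> N" for n
      proof -
        have "(f ^^ Suc n) y \<notin> ball z r"
          using y that unfolding S_def by blast
        then show ?thesis
          unfolding funpow_Suc_right comp_apply .
      qed
      moreover have "f y \<in> circle"
        using y f_im unfolding S_def by blast
      ultimately show "f y \<in> S N"
        unfolding S_def by blast
    qed
    moreover have "closed (\<Inter> (range S))" "\<Inter> (range S) \<subseteq> circle"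
      using closed by (auto simp: S_def)
    ultimately have "\<Inter> (range S) = circle"
      by (intro dense_orbit_minimal[OF f x dense])
    then have "z \<in> S 0"
      using z by blast
    with r show False
      by (simp add: S_def)
  qed
  then show ?thesis
    using that unfolding S_def by blast
qed

section \<open>Supports and atoms of stationary measures\<close>

lemma strict_mono_image_interval:
  fixes F :: "real \<Rightarrow> real"
  assumes "continuous_on UNIV F" "strict_mono F"
  shows "F ` {s..t} = {F s..F t}" "F ` {s<..<t} = {F s<..<F t}"
proof -
  note less = strict_mono_less[OF assms(2)] strict_mono_less_eq[OF assms(2)]
  have ex: "\<exists>x. y = F x" if "F s \<le> y" "y \<le> F t" for y
  proof -
    have "F s \<le> F t"
      using that by (rule order_trans)
    then have "s \<le> t"
      using less by simp
    then show ?thesis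
      using IVT'[of F s y t] that continuous_on_subset[OF assms(1)] by fastforce
  qed
  show "F ` {s..t} = {F s..F t}"
  proof (intro equalityI subsetI)
    fix y assume y: "y \<in> {F s..F t}"
    then obtain x where "y = F x"
      using ex by auto
    with y less show "y \<in> F ` {s..t}"
      by simp
  qed (use less in auto)
  show "F ` {s<..<t} = {F s<..<F t}"
  proof (intro equalityI subsetI)
    fix y assume y: "y \<in> {F s<..<F t}"
    then obtain x where "y = F x"
      using ex[of y] by auto
    with y less show "y \<in> F ` {s<..<t}"
      by simp
  qed (use less in auto)
qed

lemma not_covered_by_null_sets:
  fixes N :: nat
  assumes \<mu>: "sets \<mu> = sets circle_borel" "prob_space \<mu>"
    and W: "\<And>n. W n \<in> sets circle_borel" "\<And>n. measure \<mu> (W n) = 0"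
  shows "\<not> circle \<subseteq> (\<Union>n\<le>N. W n)"
proof
  interpret prob_space \<mu> by fact
  assume "circle \<subseteq> (\<Union>n\<le>N. W n)"
  moreover have "(\<Union>n\<le>N. W n) \<in> sets \<mu>"
    using W \<mu> by auto
  ultimately have "measure \<mu> circle \<le> measure \<mu> (\<Union>n\<le>N. W n)"
    by (rule finite_measure_mono)
  also have "\<dots> \<le> (\<Sum>n\<le>N. measure \<mu> (W n))"
    using W \<mu> by (intro finite_measure_subadditive_finite) auto
  finally show False
    using W prob_space space_circle_measure[OF \<mu>(1)] by simp
qed

text \<open>A vanishing sum of nonnegative terms with positive weights. The maps \<open>f\<close>
  are kept separate from \<open>g\<close> so that the inverse maps \<open>h\<close> can be used
  too.\<close>

lemma (in circle_ifs) null_sets_propagate: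
  assumes \<mu>: "sets \<mu> = sets circle_borel"
    and inv: "\<And>A. A \<in> sets circle_borel \<Longrightarrow> measure \<mu> A = (\<Sum>i = 1..k. p i * measure \<mu> (f i -` A \<inter> circle))"
    and A: "A \<in> sets circle_borel" "measure \<mu> A = 0" and i: "i \<in> {1..k}"
  shows "measure \<mu> (f i -` A \<inter> circle) = 0"
proof -
  have "(\<Sum>i = 1..k. p i * measure \<mu> (f i -` A \<inter> circle)) = 0"
    using inv A by simp
  then have "p i * measure \<mu> (f i -` A \<inter> circle) = 0"
    using i p_nonneg by (subst (asm) sum_nonneg_eq_0_iff) auto
  then show ?thesis
    using p_pos[OF i] by simp
qed

section \<open>Systems of homeomorphisms, their inverses and lifts\<close>

locale homeo_ifs =
  fixes k :: nat and g :: "nat \<Rightarrow> complex \<Rightarrow> complex" and p :: "nat \<Rightarrow> real"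
  assumes homeo: "i \<in> {1..k} \<Longrightarrow> g i \<in> homeo_plus"
    and p_pos: "i \<in> {1..k} \<Longrightarrow> p i > 0"
    and p_sum: "(\<Sum>i = 1..k. p i) = 1"
begin

sublocale circle_ifs k g p
proof
  fix i assume "i \<in> {1..k}"
  then have "continuous_on circle (g i)" "g i ` circle = circle"
    using homeo[of i] unfolding homeo_plus_def homeomorphism_def by blast+
  then show "continuous_on circle (g i)" "\<And>x. x \<in> circle \<Longrightarrow> g i x \<in> circle"
    by blast+
qed (use p_pos p_sum in auto)

definition h :: "nat \<Rightarrow> complex \<Rightarrow> complex" where
  "h i = (SOME h. homeomorphism circle circle (g i) h)"

lemma homeomorphism_h:
  assumes "i \<in> {1..k}"
  shows "homeomorphism circle circle (g i) (h i)"
  unfolding h_def using homeo[OF assms] by (intro someI_ex[of "homeomorphism circle circle (g i)"]) (simp add: homeo_plus_def)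

sublocale inverse: circle_ifs k h p
proof
  fix i assume "i \<in> {1..k}"
  then have "continuous_on circle (h i)" "h i ` circle = circle"
    using homeomorphism_h[of i] unfolding homeomorphism_def by blast+
  then show "continuous_on circle (h i)" "\<And>x. x \<in> circle \<Longrightarrow> h i x \<in> circle"
    by blast+
qed (use p_pos p_sum in auto)

text \<open>Converts stationarity for the inverse system into a statement about forward
  images.\<close>

lemma h_vimage:
  assumes i: "i \<in> {1..k}" and "A \<subseteq> circle"
  shows "h i -` A \<inter> circle = g i ` A"
proof -
  have "homeomorphism circle circle (g i) (h i)"
    using homeomorphism_h[OF i] .
  then have hg: "h i (g i x) = x" "g i x \<in> circle" and gh: "g i (h i x) = x" if "x \<in> circle" for x
    using that unfolding homeomorphism_def by blast+
  show ?thesis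
  proof (intro equalityI subsetI)
    fix y assume "y \<in> h i -` A \<inter> circle"
    then show "y \<in> g i ` A"
      using gh[of y] by (metis IntE image_eqI vimageE)
  next
    fix y assume "y \<in> g i ` A"
    then obtain x where "x \<in> A" "y = g i x"
      by blast
    then show "y \<in> h i -` A \<inter> circle"
      using hg[of x] \<open>A \<subseteq> circle\<close> by auto
  qed
qed

definition lift :: "nat \<Rightarrow> real \<Rightarrow> real" where
  "lift i = (SOME F. continuous_on UNIV F \<and> strict_mono F \<and> (\<forall>t n. F (t + of_int n) = F t + of_int n) \<and>
    (\<forall>t. g i (circle_param t) = circle_param (F t)))"

lemma lift:
  assumes "i \<in> {1..k}"
  shows "continuous_on UNIV (lift i)" "strict_mono (lift i)"
    "lift i (t + of_int n) = lift i t + of_int n" "g i (circle_param t) = circle_param (lift i t)"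
proof -
  have "\<exists>F. continuous_on UNIV F \<and> strict_mono F \<and> (\<forall>t n. F (t + of_int n) = F t + of_int n) \<and>
      (\<forall>t. g i (circle_param t) = circle_param (F t))"
    using homeo_plus_lift[OF homeo[OF assms]] by metis
  from someI_ex[OF this] show "continuous_on UNIV (lift i)" "strict_mono (lift i)"
      "lift i (t + of_int n) = lift i t + of_int n" "g i (circle_param t) = circle_param (lift i t)"
    unfolding lift_def by blast+
qed

text \<open>Through a lift, the image of an arc under a word becomes the image of a real interval,
  whose length can be read off its ends.\<close>

lemma word_lift:
  assumes "set w \<subseteq> {1..k}"
  obtains F where "continuous_on UNIV F" "strict_mono F" "\<And>t. F (t + 1) = F t + 1"
    "\<And>t. fold g w (circle_param t) = circle_param (F t)"
proof -
  have "\<exists>F. continuous_on UNIV F \<and> strict_mono F \<and> (\<forall>t. F (t + 1) = F t + 1) \<and>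
      (\<forall>t. fold g w (circle_param t) = circle_param (F t))"
    using assms
  proof (induction w)
    case Nil
    show ?case
      by (rule exI[of _ "\<lambda>t. t"]) (simp add: strict_mono_def)
  next
    case (Cons i w)
    then obtain F where F: "continuous_on UNIV F" "strict_mono F" "\<And>t. F (t + 1) = F t + 1"
      "\<And>t. fold g w (circle_param t) = circle_param (F t)"
      by auto
    have i: "i \<in> {1..k}"
      using Cons.prems by simp
    have "continuous_on UNIV (\<lambda>t. F (lift i t))"
      by (rule continuous_on_compose2[OF F(1) lift(1)[OF i]]) simp
    moreover have "strict_mono (\<lambda>t. F (lift i t))"
      using F(2) lift(2)[OF i] by (rule strict_mono_compose)
    moreover have "F (lift i (t + 1)) = F (lift i t) + 1" for t
      using lift(3)[OF i, of t 1] F(3) by simp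
    ultimately show ?case
      using F(4) lift(4)[OF i] by (intro exI[of _ "\<lambda>t. F (lift i t)"]) simp
  qed
  with that show ?thesis by blast
qed

end

section \<open>Full support and absence of atoms from a minimal generator\<close>

locale admissible_ifs = homeo_ifs +
  assumes admissible: "admissible k g"
begin

text \<open>If a ball were null, so would be all its preimages under powers of the minimal
  generator; by uniform return finitely many of these cover the circle.\<close>

lemma invariant_full_support:
  assumes \<mu>: "sets \<mu> = sets circle_borel" "prob_space \<mu>"
    and inv: "\<And>f. continuous_on circle f \<Longrightarrow> (\<integral>x. U f x \<partial>\<mu>) = (\<integral>x. f x \<partial>\<mu>)"
    and z: "z \<in> circle" and r: "r > 0"
  shows "measure \<mu> (ball z r \<inter> circle) > 0"
proof (rule ccontr)
  assume "\<not> ?thesis"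
  then have null: "measure \<mu> (ball z r \<inter> circle) = 0"
    using measure_nonneg[of \<mu> "ball z r \<inter> circle"] by simp
  obtain i x where i: "i \<in> {1..k}" and x: "x \<in> circle" "circle \<subseteq> closure {(g i ^^ n) x | n. n \<ge> 1}"
    using admissible unfolding admissible_def by blast
  obtain N where N: "\<And>y. y \<in> circle \<Longrightarrow> \<exists>n\<le>N. (g i ^^ n) y \<in> ball z r"
    using dense_orbit_uniform_return[OF homeo[OF i] x z r] by blast
  define W where "W n = (g i ^^ n) -` (ball z r) \<inter> circle" for n
  have W_Suc: "W (Suc n) = g i -` W n \<inter> circle" for n
    using g_in_circle[OF i] unfolding W_def funpow_Suc_right by auto
  have "W n \<in> sets circle_borel \<and> measure \<mu> (W n) = 0" for n
  proof (induction n)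
    case 0
    then show ?case
      using null ball_in_circle_borel[of z r] by (simp add: W_def)
  next
    case (Suc n)
    have "g i -` W n \<inter> circle \<in> sets circle_borel"
      using measurable_sets[OF g_measurable[OF i], of "W n"] Suc by (simp add: space_restrict_space)
    moreover have "measure \<mu> (g i -` W n \<inter> circle) = 0"
      using null_sets_propagate[OF \<mu>(1) invariant_measure_of_sets[OF \<mu> inv]] Suc i by blast
    ultimately show ?case
      unfolding W_Suc by blast
  qed
  then have "\<not> circle \<subseteq> (\<Union>n\<le>N. W n)"
    by (intro not_covered_by_null_sets[OF \<mu>]) auto
  with N show False
    unfolding W_def by blast
qed

lemma inverse_invariant_image:
  assumes \<nu>: "sets \<nu> = sets circle_borel" "prob_space \<nu>"
    and inv: "\<And>f. continuous_on circle f \<Longrightarrow> (\<integral>x. inverse.U f x \<partial>\<nu>) = (\<integral>x. f x \<partial>\<nu>)"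
    and A: "A \<in> sets circle_borel"
  shows "measure \<nu> A = (\<Sum>i = 1..k. p i * measure \<nu> (g i ` A))"
proof -
  have "A \<subseteq> circle"
    using sets.sets_into_space[OF A] by (simp add: space_restrict_space)
  then show ?thesis
    using inverse.invariant_measure_of_sets[OF \<nu> inv A] h_vimage by simp
qed

text \<open>As for the system itself, but now forward images of a null ball are null, and these have
  to cover the circle.\<close>

lemma inverse_invariant_full_support:
  assumes \<nu>: "sets \<nu> = sets circle_borel" "prob_space \<nu>"
    and inv: "\<And>f. continuous_on circle f \<Longrightarrow> (\<integral>x. inverse.U f x \<partial>\<nu>) = (\<integral>x. f x \<partial>\<nu>)"
    and z: "z \<in> circle" and r: "r > 0"
  shows "measure \<nu> (ball z r \<inter> circle) > 0"
proof (rule ccontr)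
  assume "\<not> ?thesis"
  then have null: "measure \<nu> (ball z r \<inter> circle) = 0"
    using measure_nonneg[of \<nu> "ball z r \<inter> circle"] by simp
  obtain i x where i: "i \<in> {1..k}" and x: "x \<in> circle" "circle \<subseteq> closure {(g i ^^ n) x | n. n \<ge> 1}"
    using admissible unfolding admissible_def by blast
  obtain N where N: "\<And>y. y \<in> circle \<Longrightarrow> \<exists>n\<le>N. (g i ^^ n) y \<in> ball z r"
    using dense_orbit_uniform_return[OF homeo[OF i] x z r] by blast
  define W where "W n = (g i ^^ n) ` (ball z r \<inter> circle)" for n
  have g_onto: "g i ` circle = circle"
    using homeomorphism_h[OF i] by (simp add: homeomorphism_def)
  have in_circ: "(g i ^^ n) y \<in> circle" if "y \<in> circle" for n y
    using that g_in_circle[OF i] by (induction n) auto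
  have "W n \<in> sets circle_borel \<and> measure \<nu> (W n) = 0" for n
  proof (induction n)
    case 0
    then show ?case
      using null ball_in_circle_borel[of z r] by (simp add: W_def)
  next
    case (Suc n)
    have W_Suc: "W (Suc n) = h i -` W n \<inter> circle"
      using in_circ by (subst h_vimage[OF i]) (auto simp: W_def image_image)
    have "h i -` W n \<inter> circle \<in> sets circle_borel"
      using measurable_sets[OF inverse.g_measurable[OF i], of "W n"] Suc by (simp add: space_restrict_space)
    moreover have "measure \<nu> (h i -` W n \<inter> circle) = 0"
      using null_sets_propagate[OF \<nu>(1) inverse.invariant_measure_of_sets[OF \<nu> inv]] Suc i by blast
    ultimately show ?case
      unfolding W_Suc by blast
  qed
  then have "\<not> circle \<subseteq> (\<Union>n\<le>N. W n)"
    by (intro not_covered_by_null_sets[OF \<nu>]) auto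
  \<comment> \<open>Go back \<open>N\<close> steps to a point \<open>u\<close>. Its orbit visits the
    ball at some time \<open>n\<close> at most \<open>N\<close>, so \<open>y\<close> lies in image
    number \<open>N - n\<close> of the ball.\<close>
  moreover have "y \<in> (\<Union>n\<le>N. W n)" if "y \<in> circle" for y
  proof -
    have "(g i ^^ m) ` circle = circle" for m
    proof (induction m)
      case (Suc m)
      then show ?case
        unfolding funpow.simps image_comp[symmetric] by (simp only: g_onto)
    qed simp
    then obtain u where u: "u \<in> circle" "y = (g i ^^ N) u"
      using \<open>y \<in> circle\<close> by blast
    then obtain n where n: "n \<le> N" "(g i ^^ n) u \<in> ball z r \<inter> circle"
      using N in_circ by blast
    have "y = (g i ^^ (N - n)) ((g i ^^ n) u)"
      using u n(1) by (simp flip: comp_apply[of "g i ^^ _"] funpow_add)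
    then show ?thesis
      using n by (auto simp: W_def intro!: bexI[of _ "N - n"])
  qed
  ultimately show False by blast
qed

text \<open>A maximum principle: the mass of \<open>{y}\<close> is the average of the masses of
  \<open>{g i y}\<close>, so the finite set of heaviest atoms is mapped into itself by every
  \<open>g i\<close>. Minimality would make this finite set the whole circle.\<close>

lemma inverse_invariant_atomless:
  assumes \<nu>: "sets \<nu> = sets circle_borel" "prob_space \<nu>"
    and inv: "\<And>f. continuous_on circle f \<Longrightarrow> (\<integral>x. inverse.U f x \<partial>\<nu>) = (\<integral>x. f x \<partial>\<nu>)"
    and z: "z \<in> circle"
  shows "measure \<nu> {z} = 0"
proof (rule ccontr)
  assume "measure \<nu> {z} \<noteq> 0"
  then have pos: "measure \<nu> {z} > 0"
    by (simp add: zero_less_measure_iff)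
  interpret prob_space \<nu> by fact
  have single: "{y} \<in> sets circle_borel" if "y \<in> circle" for y
    using that by (intro closed_in_circle_borel) auto
  \<comment> \<open>Atoms at least as heavy as \<open>z\<close> are finitely many because the total
    mass is one; hence a heaviest atom exists.\<close>
  define E where "E = {y \<in> circle. measure \<nu> {y} \<ge> measure \<nu> {z}}"
  have "finite E"
  proof (rule ccontr)
    assume inf: "infinite E"
    obtain m :: nat where m: "1 < real m * measure \<nu> {z}"
      using reals_Archimedean3[OF pos] by blast
    obtain T where T: "T \<subseteq> E" "finite T" "card T = m"
      using infinite_arbitrarily_large[OF inf] by metis
    have "T \<in> sets circle_borel"
      using T finite_imp_closed[OF T(2)] by (intro closed_in_circle_borel) (auto simp: E_def)
    moreover have "real m * measure \<nu> {z} \<le> (\<Sum>y\<in>T. measure \<nu> {y})"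
      using sum_bounded_below[of T "measure \<nu> {z}" "\<lambda>y. measure \<nu> {y}"] T by (auto simp: E_def)
    moreover have "(\<Sum>y\<in>T. measure \<nu> {y}) = measure \<nu> T"
      using T single \<nu>(1) by (intro measure_eq_sum_singleton[symmetric]) (auto simp: E_def)
    ultimately show False
      using m prob_le_1[of T] by linarith
  qed
  have "z \<in> E"
    using z by (simp add: E_def)
  then have "Max ((\<lambda>y. measure \<nu> {y}) ` E) \<in> (\<lambda>y. measure \<nu> {y}) ` E"
    using \<open>finite E\<close> by (intro Max_in) auto
  then obtain a where "a \<in> E" "measure \<nu> {a} = Max ((\<lambda>y. measure \<nu> {y}) ` E)"
    by auto
  then have a: "a \<in> E" "\<And>y. y \<in> E \<Longrightarrow> measure \<nu> {y} \<le> measure \<nu> {a}"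
    using \<open>finite E\<close> by auto
  have max: "measure \<nu> {y} \<le> measure \<nu> {a}" if "y \<in> circle" for y
    using that a(2)[of y] a by (cases "y \<in> E") (auto simp: E_def)
  define T where "T = {y \<in> circle. measure \<nu> {y} = measure \<nu> {a}}"
  have "T \<subseteq> E"
    using a(1) by (auto simp: T_def E_def)
  then have "finite T"
    using \<open>finite E\<close> finite_subset by blast
  obtain i x where i: "i \<in> {1..k}" and x: "x \<in> circle" "circle \<subseteq> closure {(g i ^^ n) x | n. n \<ge> 1}"
    using admissible unfolding admissible_def by blast
  have "g i y \<in> T" if "y \<in> T" for y
  proof -
    have y: "y \<in> circle" "measure \<nu> {y} = measure \<nu> {a}"
      using that by (auto simp: T_def)
    have "measure \<nu> {a} = (\<Sum>i = 1..k. p i * measure \<nu> {g i y})"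
      using inverse_invariant_image[OF \<nu> inv single[OF y(1)]] y(2) by simp
    moreover have "measure \<nu> {a} = (\<Sum>i = 1..k. p i * measure \<nu> {a})"
      using p_sum by (simp flip: sum_distrib_right)
    ultimately have "(\<Sum>i = 1..k. p i * (measure \<nu> {a} - measure \<nu> {g i y})) = 0"
      by (simp add: right_diff_distrib sum_subtractf)
    moreover have "0 \<le> p j * (measure \<nu> {a} - measure \<nu> {g j y})" if "j \<in> {1..k}" for j
      using max g_in_circle[OF that y(1)] p_nonneg[OF that] by simp
    ultimately have "p i * (measure \<nu> {a} - measure \<nu> {g i y}) = 0"
      using i by (subst (asm) sum_nonneg_eq_0_iff) auto
    then show ?thesis
      using p_pos[OF i] g_in_circle[OF i y(1)] by (simp add: T_def)
  qed
  then have "g i ` T \<subseteq> T"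
    by blast
  moreover have "T \<noteq> {}" "T \<subseteq> circle"
    using a(1) by (auto simp: T_def E_def)
  ultimately have "T = circle"
    using dense_orbit_minimal[OF homeo[OF i] x finite_imp_closed[OF \<open>finite T\<close>]] by blast
  then show False
    using \<open>finite T\<close> uncountable_circle countable_finite by blast
qed

end

section \<open>Equicontinuity\<close>

lemma arc_shift: "circle_param ` {a + of_int n..b + of_int n} = circle_param ` {a..b}"
proof -
  have "{a + of_int n..b + of_int n} = (\<lambda>t. t + of_int n) ` {a..b}"
    by (simp add: image_add_atLeastAtMost')
  then show ?thesis
    by (simp only: image_image circle_param_add_int)
qed

lemma closed_arc_in_circle_borel: "circle_param ` {s..t} \<in> sets circle_borel"
  by (intro closed_in_circle_borel compact_imp_closed compact_continuous_image continuous_circle_param) auto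

context circle_ifs
begin

lemma continuous_on_U_iterate:
  assumes "continuous_on circle f"
  shows "continuous_on circle ((U ^^ n) f)"
  by (induction n) (simp_all add: assms continuous_on_U)

lemma abs_U_iterate_le:
  assumes "\<And>x. x \<in> circle \<Longrightarrow> \<bar>f x\<bar> \<le> B" "x \<in> circle"
  shows "\<bar>(U ^^ n) f x\<bar> \<le> B"
  using assms(2)
proof (induction n arbitrary: x)
  case (Suc n)
  then show ?case
    using abs_U_le[of "(U ^^ n) f" B x] by simp
qed (simp add: assms)

end

locale inverse_stationary = admissible_ifs +
  fixes \<nu> :: "complex measure"
  assumes sets_\<nu>: "sets \<nu> = sets circle_borel" and prob_\<nu>: "prob_space \<nu>"
    and \<nu>_invariant: "\<And>f. continuous_on circle f \<Longrightarrow> (\<integral>x. inverse.U f x \<partial>\<nu>) = (\<integral>x. f x \<partial>\<nu>)"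
begin

interpretation prob_space \<nu>
  by (rule prob_\<nu>)

text \<open>Real parameters avoid cases for arcs through the base point and let lifts act directly.
  The value is \<open>0\<close> for \<open>s > t\<close> and \<open>1\<close> as soon as the
  interval has length at least one.\<close>

definition arc_measure :: "real \<Rightarrow> real \<Rightarrow> real" where
  "arc_measure s t = measure \<nu> (circle_param ` {s..t})"

lemma arc_measure_mono: "s' \<le> s \<Longrightarrow> t \<le> t' \<Longrightarrow> arc_measure s t \<le> arc_measure s' t'"
  unfolding arc_measure_def using closed_arc_in_circle_borel sets_\<nu>
  by (intro finite_measure_mono image_mono) auto

text \<open>Lifts carry arcs to arcs, and \<nu> is stationary with respect to forward images. This
  is the conservation law behind equicontinuity.\<close>

lemma arc_measure_average:
  "arc_measure s t = (\<Sum>i = 1..k. p i * arc_measure (lift i s) (lift i t))"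
proof -
  have "g i ` circle_param ` {s..t} = circle_param ` {lift i s..lift i t}" if "i \<in> {1..k}" for i
    using strict_mono_image_interval(1)[OF lift(1,2)[OF that], of s t] lift(4)[OF that]
    by (simp add: image_image flip: image_image[of circle_param "lift i"])
  then show ?thesis
    unfolding arc_measure_def
    using inverse_invariant_image[OF sets_\<nu> prob_\<nu> \<nu>_invariant closed_arc_in_circle_borel] by simp
qed

text \<open>Full support only gives positivity arc by arc. Uniformity comes from a grid: each
  interval of length \<delta> contains a grid cell, and modulo integers there are only
  \<open>N\<close> cells.\<close>

lemma arc_measure_lower_bound:
  assumes "\<delta> > 0"
  obtains c where "c > 0" "\<And>s t. s + \<delta> \<le> t \<Longrightarrow> c \<le> arc_measure s t"
proof -
  obtain m where "inverse (real (Suc m)) < \<delta> / 2"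
    using reals_Archimedean[of "\<delta> / 2"] assms by auto
  define N where "N = Suc m"
  \<comment> \<open>Rounding \<open>s\<close> up to the grid costs less than one mesh width and the
    cell takes another, hence the factor \<open>2\<close>.\<close>
  have N: "N > 0" "2 / real N < \<delta>"
    using \<open>inverse _ < _\<close> by (auto simp: N_def field_simps)
  define c where "c = Min ((\<lambda>j. arc_measure (real j / N) ((real j + 1) / N)) ` {..<N})"
  have "0 < arc_measure (real j / N) ((real j + 1) / N)" for j
  proof -
    define z where "z = (real j + 1 / 2) / N"
    have z: "z - 1 / (2 * real N) = real j / N" "z + 1 / (2 * real N) = (real j + 1) / N"
      using N by (simp_all add: z_def field_simps)
    obtain r where r: "r > 0" "\<And>y. y \<in> circle \<Longrightarrow> dist y (circle_param z) < r \<Longrightarrow>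
        \<exists>t. \<bar>t - z\<bar> < 1 / (2 * real N) \<and> y = circle_param t"
      using near_circle_param[of "1 / (2 * real N)" z] N by auto
    have "ball (circle_param z) r \<inter> circle \<subseteq> circle_param ` {real j / N..(real j + 1) / N}"
    proof
      fix y assume y: "y \<in> ball (circle_param z) r \<inter> circle"
      then have "dist y (circle_param z) < r"
        by (simp add: dist_commute)
      then obtain t where t: "\<bar>t - z\<bar> < 1 / (2 * real N)" "y = circle_param t"
        using r(2) y by blast
      then have "t \<in> {real j / N..(real j + 1) / N}"
        unfolding z[symmetric] atLeastAtMost_iff by linarith
      with t show "y \<in> circle_param ` {real j / N..(real j + 1) / N}"
        by blast
    qed
    then have "measure \<nu> (ball (circle_param z) r \<inter> circle) \<le> arc_measure (real j / N) ((real j + 1) / N)"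
      unfolding arc_measure_def using closed_arc_in_circle_borel sets_\<nu> by (intro finite_measure_mono) auto
    then show ?thesis
      using inverse_invariant_full_support[OF sets_\<nu> prob_\<nu> \<nu>_invariant circle_param_in_circle r(1)]
      by (rule less_le_trans[rotated])
  qed
  then have "c > 0"
    unfolding c_def using N by (subst Min_gr_iff) auto
  moreover have "c \<le> arc_measure s t" if st: "s + \<delta> \<le> t" for s t
  proof -
    define m where "m = \<lceil>s * N\<rceil>"
    \<comment> \<open>The cell starting at \<open>m / N\<close> is an integer translate of cell
      number \<open>j\<close>, so both have the same image on the circle.\<close>
    define j where "j = nat (m mod int N)"
    have "real_of_int m = real N * real_of_int (m div int N) + real j"
    proof -
      have "m = int N * (m div int N) + int j"
        using N by (simp add: j_def)
      then have "real_of_int m = real_of_int (int N * (m div int N) + int j)"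
        by simp
      then show ?thesis by simp
    qed
    then have m: "real_of_int m / N = real j / N + of_int (m div int N)"
      "(real_of_int m + 1) / N = (real j + 1) / N + of_int (m div int N)"
      using N by (simp_all add: field_simps)
    have "s * N \<le> m" "m < s * N + 1"
      unfolding m_def by linarith+
    then have "s \<le> m / N" "(m + 1) / N \<le> (s * N + 2) / N"
      using N by (simp add: field_simps, intro divide_right_mono) auto
    moreover have "(s * N + 2) / N = s + 2 / N"
      using N by (simp add: add_divide_distrib)
    ultimately have le: "s \<le> m / N" "(m + 1) / N \<le> t"
      using N st by linarith+
    have "j < N"
      using N by (simp add: j_def nat_less_iff)
    then have "c \<le> arc_measure (real j / N) ((real j + 1) / N)"
      unfolding c_def by (intro Min_le) auto
    also have "\<dots> = arc_measure (m / N) ((m + 1) / N)"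
      unfolding arc_measure_def of_int_add of_int_1 m arc_shift ..
    also have "\<dots> \<le> arc_measure s t"
      using le by (rule arc_measure_mono)
    finally show ?thesis .
  qed
  ultimately show ?thesis
    using that by blast
qed

text \<open>Continuity from above: closed arcs around \<open>s\<close> shrink to one point, which
  carries no mass.\<close>

lemma arc_measure_tendsto_0:
  assumes "\<epsilon> > 0"
  obtains \<eta> where "\<eta> > 0" "arc_measure (s - \<eta>) (s + \<eta>) < \<epsilon>"
proof -
  define \<eta> where "\<eta> n = inverse (real (Suc n))" for n
  define A where "A n = circle_param ` {s - \<eta> n..s + \<eta> n}" for n
  have \<eta>: "\<eta> n > 0" for n
    by (simp add: \<eta>_def)
  have "\<eta> n \<le> \<eta> m" if "m \<le> n" for m n
    using that by (simp add: \<eta>_def field_simps)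
  then have "decseq A"
    unfolding decseq_def A_def by (intro allI impI image_mono) force
  moreover have "range A \<subseteq> sets \<nu>"
    using closed_arc_in_circle_borel sets_\<nu> by (auto simp: A_def)
  ultimately have "(\<lambda>n. measure \<nu> (A n)) \<longlonglongrightarrow> measure \<nu> (\<Inter>n. A n)"
    by (intro finite_Lim_measure_decseq)
  moreover have "(\<Inter>n. A n) = {circle_param s}"
  proof (intro equalityI subsetI)
    fix y assume y: "y \<in> (\<Inter>n. A n)"
    have bound: "dist y (circle_param s) \<le> 2 * pi * \<eta> n" for n
    proof -
      obtain t where t: "t \<in> {s - \<eta> n..s + \<eta> n}" "y = circle_param t"
        using y unfolding A_def by blast
      then have "\<bar>t - s\<bar> \<le> \<eta> n"
        by auto
      then have "2 * pi * \<bar>t - s\<bar> \<le> 2 * pi * \<eta> n"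
        by (intro mult_left_mono) auto
      with dist_circle_param_le[of t s] show ?thesis
        unfolding t(2) by (rule order_trans)
    qed
    have "(\<lambda>n. 2 * pi * \<eta> n) \<longlonglongrightarrow> 2 * pi * 0"
      unfolding \<eta>_def by (intro tendsto_mult tendsto_const LIMSEQ_inverse_real_of_nat)
    then have "dist y (circle_param s) \<le> 0"
      using bound by (intro LIMSEQ_le_const[of "\<lambda>n. 2 * pi * \<eta> n"]) auto
    then show "y \<in> {circle_param s}"
      by simp
  next
    fix y assume "y \<in> {circle_param s}"
    moreover have "s \<in> {s - \<eta> n..s + \<eta> n}" for n
      using \<eta>[of n] by simp
    ultimately show "y \<in> (\<Inter>n. A n)"
      unfolding A_def by blast
  qed
  moreover have "measure \<nu> {circle_param s} = 0"
    by (intro inverse_invariant_atomless sets_\<nu> prob_\<nu> \<nu>_invariant circle_param_in_circle)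
  ultimately have "(\<lambda>n. measure \<nu> (A n)) \<longlonglongrightarrow> 0"
    by simp
  then have "\<forall>\<^sub>F n in sequentially. measure \<nu> (A n) < \<epsilon>"
    using assms by (rule order_tendstoD(2))
  then obtain n where "measure \<nu> (A n) < \<epsilon>"
    unfolding eventually_sequentially by blast
  then show ?thesis
    using that[of "\<eta> n"] \<eta> by (simp add: arc_measure_def A_def)
qed

text \<open>Uniform continuity handles short arcs. A long arc has measure at least \<open>c\<close>,
  so the constant \<open>2 * B / c\<close> absorbs the largest possible oscillation
  \<open>2 * B\<close>.\<close>

lemma arc_measure_modulus:
  assumes f: "continuous_on circle f" and "\<epsilon> > 0"
  obtains C where "C \<ge> 0"
    "\<And>s t. s \<le> t \<Longrightarrow> \<bar>f (circle_param s) - f (circle_param t)\<bar> \<le> \<epsilon> + C * arc_measure s t"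
proof -
  obtain B where B: "B > 0" "\<And>x. x \<in> circle \<Longrightarrow> \<bar>f x\<bar> \<le> B"
    using continuous_on_circle_bounded[OF f] by metis
  have "uniformly_continuous_on circle f"
    using f by (intro compact_uniformly_continuous) auto
  then obtain \<delta> where \<delta>: "\<delta> > 0"
    "\<And>x y. x \<in> circle \<Longrightarrow> y \<in> circle \<Longrightarrow> dist y x < \<delta> \<Longrightarrow> dist (f y) (f x) < \<epsilon>"
    unfolding uniformly_continuous_on_def using \<open>\<epsilon> > 0\<close> by metis
  obtain c where c: "c > 0" "\<And>s t. s + \<delta> / (2 * pi) \<le> t \<Longrightarrow> c \<le> arc_measure s t"
    using arc_measure_lower_bound[of "\<delta> / (2 * pi)"] \<delta>(1) by auto
  have "\<bar>f (circle_param s) - f (circle_param t)\<bar> \<le> \<epsilon> + 2 * B / c * arc_measure s t" if "s \<le> t" for s t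
  proof (cases "s + \<delta> / (2 * pi) \<le> t")
    case True
    have "\<bar>f (circle_param s) - f (circle_param t)\<bar> \<le> 2 * B"
      using B(2)[OF circle_param_in_circle, of s] B(2)[OF circle_param_in_circle, of t] by linarith
    also have "\<dots> \<le> 2 * B / c * arc_measure s t"
      using c(1) c(2)[OF True] B(1) by (simp add: field_simps)
    finally show ?thesis
      using \<open>\<epsilon> > 0\<close> by linarith
  next
    case False
    then have "2 * pi * \<bar>s - t\<bar> < \<delta>"
      using that by (simp add: field_simps)
    then have "dist (circle_param s) (circle_param t) < \<delta>"
      using dist_circle_param_le[of s t] by linarith
    then have "\<bar>f (circle_param s) - f (circle_param t)\<bar> < \<epsilon>"
      using \<delta>(2)[OF circle_param_in_circle circle_param_in_circle] by (simp add: dist_real_def)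
    moreover have "0 \<le> 2 * B / c * arc_measure s t"
      using B(1) c(1) by (simp add: arc_measure_def)
    ultimately show ?thesis
      by linarith
  qed
  moreover have "0 \<le> 2 * B / c"
    using B(1) c(1) by simp
  ultimately show ?thesis
    using that by blast
qed

text \<open>
  The modulus of continuity \<open>\<epsilon> + C \<nu>[s, t]\<close> is reproduced by the dual operator, since the average
  of \<open>\<nu>(g\<^sub>i[s, t])\<close> is \<open>\<nu>[s, t]\<close>.
\<close>

lemma U_iterate_modulus:
  assumes C: "C \<ge> 0"
    and f: "\<And>s t. s \<le> t \<Longrightarrow> \<bar>f (circle_param s) - f (circle_param t)\<bar> \<le> \<epsilon> + C * arc_measure s t"
    and "s \<le> t"
  shows "\<bar>(U ^^ n) f (circle_param s) - (U ^^ n) f (circle_param t)\<bar> \<le> \<epsilon> + C * arc_measure s t"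
  using \<open>s \<le> t\<close>
proof (induction n arbitrary: s t)
  case 0
  then show ?case using f by simp
next
  case (Suc n)
  let ?\<phi> = "\<lambda>t. (U ^^ n) f (circle_param t)"
  have U: "(U ^^ Suc n) f (circle_param u) = (\<Sum>i = 1..k. p i * ?\<phi> (lift i u))" for u
    using lift(4) by (simp add: dual_op_def)
  have "\<bar>(U ^^ Suc n) f (circle_param s) - (U ^^ Suc n) f (circle_param t)\<bar> =
      \<bar>\<Sum>i = 1..k. p i * (?\<phi> (lift i s) - ?\<phi> (lift i t))\<bar>"
    unfolding U by (simp only: right_diff_distrib sum_subtractf)
  also have "\<dots> \<le> (\<Sum>i = 1..k. \<bar>p i * (?\<phi> (lift i s) - ?\<phi> (lift i t))\<bar>)"
    by (rule sum_abs)
  also have "\<dots> \<le> (\<Sum>i = 1..k. p i * (\<epsilon> + C * arc_measure (lift i s) (lift i t)))"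
  proof (rule sum_mono)
    fix i assume i: "i \<in> {1..k}"
    have "lift i s \<le> lift i t"
      using strict_mono_less_eq[OF lift(2)[OF i]] Suc.prems by simp
    then show "\<bar>p i * (?\<phi> (lift i s) - ?\<phi> (lift i t))\<bar> \<le> p i * (\<epsilon> + C * arc_measure (lift i s) (lift i t))"
      using Suc.IH p_nonneg[OF i] by (simp add: abs_mult mult_left_mono)
  qed
  also have "\<dots> = \<epsilon> * (\<Sum>i = 1..k. p i) + C * (\<Sum>i = 1..k. p i * arc_measure (lift i s) (lift i t))"
    unfolding distrib_left sum.distrib sum_distrib_left by (simp only: mult.commute mult.left_commute)
  also have "\<dots> = \<epsilon> + C * arc_measure s t"
    by (simp only: p_sum arc_measure_average[of s t, symmetric] mult_1_right)
  finally show ?case .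
qed

text \<open>The modulus \<open>\<epsilon> / 2 + C * arc_measure s t\<close> does not depend on
  \<open>n\<close>, and its arc term is small near \<open>x\<close> because \<nu> has no
  atoms.\<close>

lemma U_iterates_equicontinuous:
  assumes f: "continuous_on circle f" and "x \<in> circle" "\<epsilon> > 0"
  obtains \<delta> where "\<delta> > 0"
    "\<And>n y. y \<in> circle \<Longrightarrow> dist y x < \<delta> \<Longrightarrow> \<bar>(U ^^ n) f y - (U ^^ n) f x\<bar> < \<epsilon>"
proof -
  obtain s where s: "x = circle_param s"
    using circle_param_surj[OF \<open>x \<in> circle\<close>] by metis
  obtain C where C: "C \<ge> 0"
    "\<And>s t. s \<le> t \<Longrightarrow> \<bar>f (circle_param s) - f (circle_param t)\<bar> \<le> \<epsilon> / 2 + C * arc_measure s t"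
    using arc_measure_modulus[OF f, of "\<epsilon> / 2"] \<open>\<epsilon> > 0\<close> by auto
  \<comment> \<open>\<open>C + 1\<close> replaces \<open>C\<close> since \<open>C\<close> may be
    zero.\<close>
  have "\<epsilon> / (2 * (C + 1)) > 0"
    using C(1) \<open>\<epsilon> > 0\<close> by simp
  then obtain \<eta> where \<eta>: "\<eta> > 0" "arc_measure (s - \<eta>) (s + \<eta>) < \<epsilon> / (2 * (C + 1))"
    by (rule arc_measure_tendsto_0)
  have "C * arc_measure (s - \<eta>) (s + \<eta>) \<le> (C + 1) * arc_measure (s - \<eta>) (s + \<eta>)"
    by (intro mult_right_mono) (simp_all add: arc_measure_def)
  also have "\<dots> < \<epsilon> / 2"
    using \<eta>(2) C(1) by (simp add: field_simps)
  finally have small: "C * arc_measure (s - \<eta>) (s + \<eta>) < \<epsilon> / 2" .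
  obtain \<delta> where \<delta>: "\<delta> > 0" "\<And>y. y \<in> circle \<Longrightarrow> dist y (circle_param s) < \<delta> \<Longrightarrow>
      \<exists>t. \<bar>t - s\<bar> < \<eta> \<and> y = circle_param t"
    using near_circle_param[OF \<eta>(1)] by blast
  have "\<bar>(U ^^ n) f y - (U ^^ n) f x\<bar> < \<epsilon>" if y: "y \<in> circle" "dist y x < \<delta>" for n y
  proof -
    obtain t where t: "\<bar>t - s\<bar> < \<eta>" "y = circle_param t"
      using \<delta>(2) y s by blast
    have "\<bar>(U ^^ n) f y - (U ^^ n) f x\<bar> \<le> \<epsilon> / 2 + C * arc_measure (min s t) (max s t)"
      using U_iterate_modulus[OF C, of "min s t" "max s t" n] t(2) s
      by (cases "s \<le> t") (simp_all add: min_def max_def abs_minus_commute)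
    also have "\<dots> \<le> \<epsilon> / 2 + C * arc_measure (s - \<eta>) (s + \<eta>)"
      using t(1) C(1) by (intro add_left_mono mult_left_mono arc_measure_mono) auto
    finally show ?thesis
      using small by simp
  qed
  with \<delta>(1) that show ?thesis by blast
qed

end

section \<open>Convergence\<close>

lemma prob_measures_eqI:
  assumes M: "M \<in> prob_measures" and N: "N \<in> prob_measures"
    and eq: "\<And>f :: complex \<Rightarrow> real. continuous_on circle f \<Longrightarrow> (\<integral>x. f x \<partial>M) = (\<integral>x. f x \<partial>N)"
  shows "M = N"
proof (rule measure_eqI)
  have sets: "sets M = sets circle_borel" "sets N = sets circle_borel"
    using M N by (auto simp: prob_measures_def)
  then show "sets M = sets N" by simp
  interpret M: prob_space M
    using M by (simp add: prob_measures_def)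
  interpret N: prob_space N
    using N by (simp add: prob_measures_def)
  fix A assume "A \<in> sets M"
  then have A: "A \<in> sets circle_borel"
    using sets by simp
  define L where "L b = (if b then M else N)" for b
  define c :: "bool \<Rightarrow> real" where "c b = (if b then 1 else - 1)" for b
  have "(\<Sum>b\<in>UNIV. c b * measure (L b) A) = 0"
  proof (rule signed_measure_zero[OF _ _ _ A])
    show "sets (L b) = sets circle_borel" "finite_measure (L b)" for b
      using sets M.finite_measure_axioms N.finite_measure_axioms by (simp_all add: L_def)
    show "(\<Sum>b\<in>UNIV. c b * (\<integral>x. f x \<partial>L b)) = 0" if "continuous_on circle f" for f :: "complex \<Rightarrow> real"
      using eq[OF that] by (simp add: UNIV_bool c_def L_def)
  qed
  then have "measure M A = measure N A"
    by (simp add: UNIV_bool c_def L_def)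
  then show "emeasure M A = emeasure N A"
    by (simp add: M.emeasure_eq_measure N.emeasure_eq_measure)
qed

context homeo_ifs
begin

text \<open>The image measure is a mixture: draw an index with law \<open>P\<close>, then push
  \<rho> forward by the chosen map. Mass and integrals follow from the general theory of
  bind.\<close>

lemma markov_op_prob_and_integral:
  assumes \<rho>: "\<rho> \<in> prob_measures"
  shows "markov_op k g p \<rho> \<in> prob_measures"
    and "continuous_on circle f \<Longrightarrow> (\<integral>x. f x \<partial>markov_op k g p \<rho>) = (\<integral>x. U f x \<partial>\<rho>)"
proof -
  have sets_\<rho>: "sets \<rho> = sets circle_borel"
    using \<rho> by (simp add: prob_measures_def)
  interpret prob_space \<rho>
    using \<rho> by (simp add: prob_measures_def)
  obtain P where setP: "set_pmf P \<subseteq> {1..k}" and P: "\<And>i. i \<in> {1..k} \<Longrightarrow> pmf P i = p i"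
    using weight_pmf by blast
  \<comment> \<open>The kernel must consist of probability measures at every natural index, so
    indices that are never drawn get the identity map.\<close>
  define g' where "g' i = (if i \<in> {1..k} then g i else (\<lambda>x. x))" for i
  have g': "g' i \<in> \<rho> \<rightarrow>\<^sub>M circle_borel" for i
    using g_measurable by (simp add: g'_def cong: measurable_cong_sets[OF sets_\<rho> refl])
  define D where "D i = distr \<rho> circle_borel (g' i)" for i
  have D: "prob_space (D i)" for i
    unfolding D_def by (intro prob_space_distr g')
  have sets_D: "sets (D i) = sets circle_borel" for i
    by (simp add: D_def)
  have "D \<in> UNIV \<rightarrow> space (subprob_algebra circle_borel)"
    using D sets_D by (auto simp: space_subprob_algebra prob_space_imp_subprob_space)
  then have D_meas: "D \<in> measure_pmf P \<rightarrow>\<^sub>M subprob_algebra circle_borel"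
    by simp
  have markov: "markov_op k g p \<rho> = measure_pmf P \<bind> D"
  proof (rule measure_eqI)
    show sets: "sets (markov_op k g p \<rho>) = sets (measure_pmf P \<bind> D)"
      using sets_bind[of "measure_pmf P" D circle_borel] sets_D by simp
    fix A assume "A \<in> sets (markov_op k g p \<rho>)"
    then have A: "A \<in> sets circle_borel" by simp
    have "emeasure (measure_pmf P \<bind> D) A = (\<integral>\<^sup>+i. emeasure (D i) A \<partial>measure_pmf P)"
      by (rule emeasure_bind[OF _ D_meas A]) simp
    also have "\<dots> = (\<Sum>i = 1..k. emeasure (D i) A * ennreal (pmf P i))"
      using setP by (intro nn_integral_measure_pmf_support) auto
    also have "\<dots> = (\<Sum>i = 1..k. ennreal (p i) * emeasure \<rho> (g i -` A \<inter> circle))"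
    proof (intro sum.cong refl)
      fix i assume i: "i \<in> {1..k}"
      have "emeasure (D i) A = emeasure \<rho> (g' i -` A \<inter> space \<rho>)"
        unfolding D_def using g' A by (rule emeasure_distr)
      then show "emeasure (D i) A * ennreal (pmf P i) = ennreal (p i) * emeasure \<rho> (g i -` A \<inter> circle)"
        using i P[OF i] space_circle_measure[OF sets_\<rho>] by (simp add: g'_def mult.commute)
    qed
    also have "\<dots> = emeasure (markov_op k g p \<rho>) A"
      using emeasure_markov_op[OF homeo sets_\<rho> A] by simp
    finally show "emeasure (markov_op k g p \<rho>) A = emeasure (measure_pmf P \<bind> D) A" ..
  qed
  have "D \<in> measure_pmf P \<rightarrow>\<^sub>M prob_algebra circle_borel"
    using D sets_D by (simp add: space_prob_algebra)
  then have "prob_space (measure_pmf P \<bind> D)"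
    by (intro prob_space_bind'[of _ "measure_pmf P"]) (simp_all add: space_prob_algebra prob_space_measure_pmf)
  then show "markov_op k g p \<rho> \<in> prob_measures"
    by (simp add: prob_measures_def markov[symmetric])
  assume f: "continuous_on circle f"
  obtain B where B: "\<And>x. x \<in> circle \<Longrightarrow> \<bar>f x\<bar> \<le> B"
    using continuous_on_circle_bounded[OF f] by metis
  have "emeasure (D i) (space (D i)) \<le> ennreal 1" for i
    using prob_space.emeasure_space_1[OF D] by simp
  then have "(\<integral>x. f x \<partial>(measure_pmf P \<bind> D)) = (\<integral>i. (\<integral>x. f x \<partial>D i) \<partial>measure_pmf P)"
    using B by (intro integral_bind[OF borel_measurable_circle[OF refl f] _ D_meas, of B 1])
      (simp_all add: space_restrict_space measure_pmf.finite_measure_axioms)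
  also have "\<dots> = (\<Sum>i = 1..k. (\<integral>x. f x \<partial>D i) * pmf P i)"
    using setP by (intro integral_measure_pmf_real) auto
  also have "\<dots> = (\<Sum>i = 1..k. p i * (\<integral>x. f (g i x) \<partial>\<rho>))"
  proof (intro sum.cong refl)
    fix i assume i: "i \<in> {1..k}"
    have "(\<integral>x. f x \<partial>D i) = (\<integral>x. f (g' i x) \<partial>\<rho>)"
      unfolding D_def by (intro integral_distr g' borel_measurable_circle[OF refl f])
    then show "(\<integral>x. f x \<partial>D i) * pmf P i = p i * (\<integral>x. f (g i x) \<partial>\<rho>)"
      using i P[OF i] by (simp add: g'_def)
  qed
  also have "\<dots> = (\<integral>x. U f x \<partial>\<rho>)"
    using integral_U[OF sets_\<rho> finite_measure_axioms f] by simp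
  finally show "(\<integral>x. f x \<partial>markov_op k g p \<rho>) = (\<integral>x. U f x \<partial>\<rho>)"
    unfolding markov .
qed

lemma markov_op_iterate:
  assumes "\<rho> \<in> prob_measures"
  shows "(markov_op k g p ^^ n) \<rho> \<in> prob_measures"
    and "continuous_on circle f \<Longrightarrow> (\<integral>x. f x \<partial>((markov_op k g p ^^ n) \<rho>)) = (\<integral>x. (U ^^ n) f x \<partial>\<rho>)"
proof -
  show prob: "(markov_op k g p ^^ n) \<rho> \<in> prob_measures" for n
    by (induction n) (simp_all add: assms markov_op_prob_and_integral(1))
  show "(\<integral>x. f x \<partial>((markov_op k g p ^^ n) \<rho>)) = (\<integral>x. (U ^^ n) f x \<partial>\<rho>)"
    if "continuous_on circle f"
    using that
  proof (induction n arbitrary: f)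
    case (Suc n)
    have "(\<integral>x. f x \<partial>((markov_op k g p ^^ Suc n) \<rho>)) = (\<integral>x. U f x \<partial>((markov_op k g p ^^ n) \<rho>))"
      using markov_op_prob_and_integral(2)[OF prob Suc.prems] by simp
    also have "\<dots> = (\<integral>x. (U ^^ n) (U f) x \<partial>\<rho>)"
      by (rule Suc.IH[OF continuous_on_U[OF Suc.prems]])
    finally show ?case
      by (simp only: funpow_Suc_right comp_apply)
  qed simp
qed

end

section \<open>Decay of variance and its consequences along words\<close>

locale stationary_ifs = inverse_stationary +
  fixes \<mu> :: "complex measure"
  assumes sets_\<mu>: "sets \<mu> = sets circle_borel" and prob_\<mu>: "prob_space \<mu>"
    and \<mu>_invariant: "\<And>f. continuous_on circle f \<Longrightarrow> (\<integral>x. U f x \<partial>\<mu>) = (\<integral>x. f x \<partial>\<mu>)"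
begin

interpretation prob_space \<mu>
  by (rule prob_\<mu>)

lemma integrable_\<mu>:
  fixes f :: "complex \<Rightarrow> real"
  shows "continuous_on circle f \<Longrightarrow> integrable \<mu> f"
  by (rule integrable_continuous_circle[OF sets_\<mu> finite_measure_axioms])

lemma continuous_on_compose_g:
  "continuous_on circle f \<Longrightarrow> i \<in> {1..k} \<Longrightarrow> continuous_on circle (\<lambda>x. f (g i x))"
  using g_in_circle by (intro continuous_on_compose2[of circle f, OF _ cont_g]) auto

text \<open>Pointwise, the left side is the variance of \<open>\<phi> (g i x)\<close> for a random
  index: mean of squares minus square of the mean \<open>U \<phi> x\<close>. Stationarity then
  removes \<open>U\<close> from the integrated mean of squares.\<close>

lemma integral_U_variance:
  assumes \<phi>: "continuous_on circle \<phi>"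
  shows "(\<Sum>i = 1..k. p i * (\<integral>x. (\<phi> (g i x) - U \<phi> x)\<^sup>2 \<partial>\<mu>)) = (\<integral>x. (\<phi> x)\<^sup>2 \<partial>\<mu>) - (\<integral>x. (U \<phi> x)\<^sup>2 \<partial>\<mu>)"
proof -
  have cont: "continuous_on circle (\<lambda>x. (\<phi> (g i x) - U \<phi> x)\<^sup>2)" if "i \<in> {1..k}" for i
    by (intro continuous_on_power continuous_on_diff continuous_on_compose_g \<phi> continuous_on_U that)
  have sq: "continuous_on circle (\<lambda>x. (\<phi> x)\<^sup>2)" "continuous_on circle (\<lambda>x. (U \<phi> x)\<^sup>2)"
    by (intro continuous_on_power continuous_on_U \<phi>)+
  have pointwise: "(\<Sum>i = 1..k. p i * (\<phi> (g i x) - U \<phi> x)\<^sup>2) = U (\<lambda>x. (\<phi> x)\<^sup>2) x - (U \<phi> x)\<^sup>2" for x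
  proof -
    have "(\<Sum>i = 1..k. p i * (\<phi> (g i x) - U \<phi> x)\<^sup>2) =
        (\<Sum>i = 1..k. p i * (\<phi> (g i x))\<^sup>2 - 2 * U \<phi> x * (p i * \<phi> (g i x)) + (U \<phi> x)\<^sup>2 * p i)"
      by (intro sum.cong refl) (simp add: power2_eq_square algebra_simps)
    also have "\<dots> = (\<Sum>i = 1..k. p i * (\<phi> (g i x))\<^sup>2) - 2 * U \<phi> x * (\<Sum>i = 1..k. p i * \<phi> (g i x))
        + (U \<phi> x)\<^sup>2 * (\<Sum>i = 1..k. p i)"
      by (simp only: sum.distrib sum_subtractf sum_distrib_left)
    also have "(\<Sum>i = 1..k. p i * \<phi> (g i x)) = U \<phi> x"
      by (simp add: dual_op_def)
    also have "(\<Sum>i = 1..k. p i * (\<phi> (g i x))\<^sup>2) = U (\<lambda>x. (\<phi> x)\<^sup>2) x"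
      by (simp add: dual_op_def)
    finally show ?thesis
      using p_sum by (simp add: power2_eq_square)
  qed
  have "(\<Sum>i = 1..k. p i * (\<integral>x. (\<phi> (g i x) - U \<phi> x)\<^sup>2 \<partial>\<mu>)) =
      (\<integral>x. (\<Sum>i = 1..k. p i * (\<phi> (g i x) - U \<phi> x)\<^sup>2) \<partial>\<mu>)"
    using integrable_\<mu>[OF cont] by (subst Bochner_Integration.integral_sum) auto
  also have "\<dots> = (\<integral>x. U (\<lambda>x. (\<phi> x)\<^sup>2) x \<partial>\<mu>) - (\<integral>x. (U \<phi> x)\<^sup>2 \<partial>\<mu>)"
    unfolding pointwise
    by (intro Bochner_Integration.integral_diff integrable_\<mu> sq continuous_on_U)
  finally show ?thesis
    using \<mu>_invariant[OF sq(1)] by simp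
qed

text \<open>The numbers \<open>V n\<close> decrease and are nonnegative, so their decrements tend to
  zero; each weighted summand is bounded by the decrement, and \<open>p i\<close> is
  positive.\<close>

lemma variance_tendsto_0:
  assumes f: "continuous_on circle f" and i: "i \<in> {1..k}"
  shows "(\<lambda>n. \<integral>x. ((U ^^ n) f (g i x) - (U ^^ Suc n) f x)\<^sup>2 \<partial>\<mu>) \<longlonglongrightarrow> 0"
proof -
  define V where "V n = (\<integral>x. ((U ^^ n) f x)\<^sup>2 \<partial>\<mu>)" for n
  define W where "W n j = (\<integral>x. ((U ^^ n) f (g j x) - (U ^^ Suc n) f x)\<^sup>2 \<partial>\<mu>)" for n j
  have W: "W n j \<ge> 0" for n j
    by (simp add: W_def)
  have VW: "(\<Sum>j = 1..k. p j * W n j) = V n - V (Suc n)" for n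
    using integral_U_variance[OF continuous_on_U_iterate[OF f]] by (simp add: V_def W_def)
  have nonneg: "0 \<le> p j * W n j" if "j \<in> {1..k}" for n j
    using W p_nonneg[OF that] by simp
  have "decseq V"
    unfolding decseq_Suc_iff
  proof
    fix n
    have "0 \<le> (\<Sum>j = 1..k. p j * W n j)"
      using nonneg by (rule sum_nonneg)
    then show "V (Suc n) \<le> V n"
      unfolding VW by simp
  qed
  moreover have "0 \<le> V n" for n
    by (simp add: V_def)
  ultimately obtain l where "V \<longlonglongrightarrow> l"
    using decseq_convergent by blast
  then have "(\<lambda>n. (V n - V (Suc n)) / p i) \<longlonglongrightarrow> (l - l) / p i"
    using p_pos[OF i] by (intro tendsto_divide tendsto_diff tendsto_const LIMSEQ_Suc) auto
  moreover have "W n i \<le> (V n - V (Suc n)) / p i" for n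
  proof -
    have "p i * W n i \<le> (\<Sum>j = 1..k. p j * W n j)"
      using i nonneg by (intro member_le_sum) auto
    then show ?thesis
      unfolding VW using p_pos[OF i] by (simp add: field_simps)
  qed
  ultimately have "(\<lambda>n. W n i) \<longlonglongrightarrow> 0"
    using tendsto_sandwich[of "\<lambda>_. 0" "\<lambda>n. W n i" sequentially "\<lambda>n. (V n - V (Suc n)) / p i" 0] W
    by (simp only: always_eventually tendsto_const diff_self div_0 simp_thms)
  then show ?thesis
    by (simp add: W_def)
qed

text \<open>Upgrades mean square convergence to pointwise convergence. By equicontinuity, a value of
  size \<epsilon> at \<open>x\<close> persists as at least \<open>\<epsilon> / 2\<close> on a ball
  independent of \<open>n\<close>; this ball has positive mass \<open>m\<close>, so the integral
  would stay above \<open>(\<epsilon> / 2)\<^sup>2 * m\<close>.\<close>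

lemma one_step_tendsto_0:
  assumes f: "continuous_on circle f" and i: "i \<in> {1..k}" and x: "x \<in> circle"
  shows "(\<lambda>n. (U ^^ n) f (g i x) - (U ^^ Suc n) f x) \<longlonglongrightarrow> 0"
proof (rule LIMSEQ_I)
  fix \<epsilon> :: real assume "\<epsilon> > 0"
  define D where "D n y = (U ^^ n) f (g i y) - (U ^^ Suc n) f y" for n y
  have contD: "continuous_on circle (D n)" for n
    unfolding D_def by (intro continuous_on_diff continuous_on_compose_g continuous_on_U_iterate f i)
  obtain \<delta>1 where \<delta>1: "\<delta>1 > 0"
    "\<And>n y. y \<in> circle \<Longrightarrow> dist y (g i x) < \<delta>1 \<Longrightarrow> \<bar>(U ^^ n) f y - (U ^^ n) f (g i x)\<bar> < \<epsilon> / 4"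
    using U_iterates_equicontinuous[OF f g_in_circle[OF i x], of "\<epsilon> / 4"] \<open>\<epsilon> > 0\<close> by auto
  obtain \<delta>2 where \<delta>2: "\<delta>2 > 0"
    "\<And>n y. y \<in> circle \<Longrightarrow> dist y x < \<delta>2 \<Longrightarrow> \<bar>(U ^^ n) f y - (U ^^ n) f x\<bar> < \<epsilon> / 4"
    using U_iterates_equicontinuous[OF f x, of "\<epsilon> / 4"] \<open>\<epsilon> > 0\<close> by auto
  \<comment> \<open>Equicontinuity is needed at both \<open>g i x\<close> and \<open>x\<close>;
    continuity of \<open>g i\<close> transports the first neighbourhood back to
    \<open>x\<close>.\<close>
  obtain \<delta>3 where \<delta>3: "\<delta>3 > 0" "\<And>y. y \<in> circle \<Longrightarrow> dist y x < \<delta>3 \<Longrightarrow> dist (g i y) (g i x) < \<delta>1"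
    using cont_g[OF i] x \<delta>1(1) unfolding continuous_on_iff by blast
  define r where "r = min \<delta>2 \<delta>3"
  have r: "r > 0"
    using \<delta>2 \<delta>3 by (simp add: r_def)
  have near: "\<bar>D n y - D n x\<bar> < \<epsilon> / 2" if y: "y \<in> ball x r \<inter> circle" for n y
  proof -
    have "y \<in> circle" "dist y x < \<delta>2" "dist y x < \<delta>3"
      using y by (auto simp: r_def dist_commute)
    then have "\<bar>(U ^^ n) f (g i y) - (U ^^ n) f (g i x)\<bar> < \<epsilon> / 4"
      "\<bar>(U ^^ Suc n) f y - (U ^^ Suc n) f x\<bar> < \<epsilon> / 4"
      using \<delta>1(2) \<delta>2(2) \<delta>3(2) g_in_circle[OF i] by blast+
    then show ?thesis
      unfolding D_def by linarith
  qed
  define m where "m = measure \<mu> (ball x r \<inter> circle)"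
  have "m > 0"
    unfolding m_def by (intro invariant_full_support sets_\<mu> prob_\<mu> \<mu>_invariant x r)
  have "(\<epsilon> / 2)\<^sup>2 * m \<le> (\<integral>y. (D n y)\<^sup>2 \<partial>\<mu>)" if far: "\<epsilon> \<le> \<bar>D n x\<bar>" for n
  proof -
    have ball: "ball x r \<inter> circle \<in> sets \<mu>"
      using ball_in_circle_borel sets_\<mu> by blast
    have "(\<epsilon> / 2)\<^sup>2 * m = (\<integral>y. (\<epsilon> / 2)\<^sup>2 * indicator (ball x r \<inter> circle) y \<partial>\<mu>)"
      using ball by (simp add: m_def)
    also have "\<dots> \<le> (\<integral>y. (D n y)\<^sup>2 \<partial>\<mu>)"
    proof (rule integral_mono)
      show "integrable \<mu> (\<lambda>y. (\<epsilon> / 2)\<^sup>2 * indicator (ball x r \<inter> circle) y)"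
        using ball by (intro integrable_mult_right integrable_real_indicator) (simp_all add: emeasure_eq_measure)
      show "integrable \<mu> (\<lambda>y. (D n y)\<^sup>2)"
        by (intro integrable_\<mu> continuous_on_power contD)
      show "(\<epsilon> / 2)\<^sup>2 * indicator (ball x r \<inter> circle) y \<le> (D n y)\<^sup>2" for y
      proof (cases "y \<in> ball x r \<inter> circle")
        case True
        then have "\<epsilon> / 2 \<le> \<bar>D n y\<bar>"
          using near[OF True, of n] far by linarith
        then have "(\<epsilon> / 2)\<^sup>2 \<le> \<bar>D n y\<bar>\<^sup>2"
          using \<open>\<epsilon> > 0\<close> by (intro power_mono) auto
        then show ?thesis
          using True by simp
      next
        case False
        then have "indicator (ball x r \<inter> circle) y = (0 :: real)"
          by (rule indicator_simps(2))
        then show ?thesis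
          by (simp only: mult_zero_right zero_le_power2)
      qed
    qed
    finally show ?thesis .
  qed
  moreover have "\<forall>\<^sub>F n in sequentially. (\<integral>y. (D n y)\<^sup>2 \<partial>\<mu>) < (\<epsilon> / 2)\<^sup>2 * m"
    using variance_tendsto_0[OF f i] \<open>m > 0\<close> \<open>\<epsilon> > 0\<close> unfolding D_def by (intro order_tendstoD(2)) auto
  ultimately have "\<forall>\<^sub>F n in sequentially. \<bar>D n x\<bar> < \<epsilon>"
    by (elim eventually_mono) (meson not_less)
  then show "\<exists>N. \<forall>n\<ge>N. norm ((U ^^ n) f (g i x) - (U ^^ Suc n) f x - 0) < \<epsilon>"
    by (simp add: D_def eventually_sequentially)
qed

text \<open>Telescoping over letters: the induction hypothesis is used at \<open>g i x\<close>, and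
  the one-step limit with time shifted by the length of the remaining word.\<close>

lemma word_tendsto_0:
  assumes f: "continuous_on circle f" and "set w \<subseteq> {1..k}" "x \<in> circle"
  shows "(\<lambda>n. (U ^^ n) f (fold g w x) - (U ^^ (n + length w)) f x) \<longlonglongrightarrow> 0"
  using assms(2,3)
proof (induction w arbitrary: x)
  case (Cons i w)
  then have i: "i \<in> {1..k}" and "set w \<subseteq> {1..k}" "g i x \<in> circle"
    using g_in_circle by auto
  then have "(\<lambda>n. (U ^^ n) f (fold g w (g i x)) - (U ^^ (n + length w)) f (g i x)) \<longlonglongrightarrow> 0"
    using Cons.IH by blast
  moreover have "(\<lambda>n. (U ^^ (n + length w)) f (g i x) - (U ^^ Suc (n + length w)) f x) \<longlonglongrightarrow> 0"
    using LIMSEQ_ignore_initial_segment[OF one_step_tendsto_0[OF f i Cons.prems(2)]] .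
  ultimately have "(\<lambda>n. (U ^^ n) f (fold g w (g i x)) - (U ^^ (n + length w)) f (g i x) +
      ((U ^^ (n + length w)) f (g i x) - (U ^^ Suc (n + length w)) f x)) \<longlonglongrightarrow> 0 + 0"
    by (rule tendsto_add)
  then show ?case by simp
qed simp

end

section \<open>Contraction and asymptotic stability\<close>

locale contractive_ifs = stationary_ifs +
  assumes contractive: "contractive k g"
begin

interpretation prob_space \<mu>
  by (rule prob_\<mu>)

text \<open>The radius \<delta> keeps \<open>y\<close> inside the arc given by contractivity. It is
  fixed before \<epsilon> because the words of the whole sequence shrink the same arc, and the
  length of the image arc controls the distance of the two images.\<close>

lemma contraction_near:
  assumes "x \<in> circle"
  obtains \<delta> where "\<delta> > 0"
    "\<And>y \<epsilon>. y \<in> circle \<Longrightarrow> dist y x < \<delta> \<Longrightarrow> \<epsilon> > 0 \<Longrightarrow>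
      \<exists>w. set w \<subseteq> {1..k} \<and> dist (fold g w y) (fold g w x) < \<epsilon>"
proof -
  obtain I w where I: "open_arc I" "x \<in> I" and w: "\<And>m. w m \<in> words k"
    and lim: "(\<lambda>m. arc_length (fold g (w m) ` I)) \<longlonglongrightarrow> 0"
    using contractive assms unfolding contractive_def by blast
  obtain a b where ab: "a < b" "b \<le> a + 1" "I = circle_param ` {a<..<b}"
    using I(1) unfolding open_arc_def by blast
  obtain s where s: "a < s" "s < b" "x = circle_param s"
    using I(2) ab(3) by auto
  obtain \<delta> where \<delta>: "\<delta> > 0" "\<And>y. y \<in> circle \<Longrightarrow> dist y (circle_param s) < \<delta> \<Longrightarrow>
      \<exists>t. \<bar>t - s\<bar> < min (s - a) (b - s) \<and> y = circle_param t"
    using near_circle_param[of "min (s - a) (b - s)" s] s by auto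
  have "\<exists>v. set v \<subseteq> {1..k} \<and> dist (fold g v y) (fold g v x) < \<epsilon>"
    if y: "y \<in> circle" "dist y x < \<delta>" and "\<epsilon> > 0" for y \<epsilon>
  proof -
    obtain t where t: "\<bar>t - s\<bar> < min (s - a) (b - s)" "y = circle_param t"
      using \<delta>(2) y s(3) by blast
    then have "a < t" "t < b"
      by linarith+
    have "\<forall>\<^sub>F m in sequentially. arc_length (fold g (w m) ` I) < \<epsilon> / (2 * pi)"
      using lim \<open>\<epsilon> > 0\<close> by (intro order_tendstoD(2)) auto
    then obtain m where m: "arc_length (fold g (w m) ` I) < \<epsilon> / (2 * pi)"
      unfolding eventually_sequentially by blast
    have wm: "set (w m) \<subseteq> {1..k}"
      using w[of m] by (simp add: words_def)
    obtain F where F: "continuous_on UNIV F" "strict_mono F" "\<And>t. F (t + 1) = F t + 1"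
      "\<And>t. fold g (w m) (circle_param t) = circle_param (F t)"
      using word_lift[OF wm] by blast
    have less: "F u < F v" if "u < v" for u v
      using F(2) that by (rule strict_monoD)
    have "fold g (w m) ` I = circle_param ` {F a<..<F b}"
      unfolding ab(3) strict_mono_image_interval(2)[OF F(1,2), symmetric] by (simp add: image_image F(4))
    \<comment> \<open>The image interval does not wrap around the circle more than once, as the
      length formula requires.\<close>
    moreover have "F b \<le> F a + 1"
      using strict_mono_less_eq[OF F(2), of b "a + 1"] ab(2) F(3) by simp
    ultimately have "arc_length (fold g (w m) ` I) = F b - F a"
      using arc_length_arc[OF less[OF ab(1)]] by simp
    moreover have "\<bar>F t - F s\<bar> < F b - F a"
      using less[OF \<open>a < t\<close>] less[OF \<open>t < b\<close>] less[OF s(1)] less[OF s(2)] by linarith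
    ultimately have "\<bar>F t - F s\<bar> < \<epsilon> / (2 * pi)"
      using m by linarith
    then have "2 * pi * \<bar>F t - F s\<bar> < \<epsilon>"
      by (simp add: field_simps)
    then have "dist (fold g (w m) y) (fold g (w m) x) < \<epsilon>"
      using dist_circle_param_le[of "F t" "F s"] unfolding t(2) s(3) F(4) by linarith
    with wm show ?thesis by blast
  qed
  with \<delta>(1) that show ?thesis
    unfolding s(3) by blast
qed

text \<open>For a contracting word \<open>w\<close>, the values at \<open>x\<close> and
  \<open>y\<close> at time \<open>n + length w\<close> are compared with those at the images of
  \<open>x\<close> and \<open>y\<close> under \<open>w\<close> at time \<open>n\<close>. The latter
  are close by equicontinuity.\<close>

lemma asymptotically_constant_near:
  assumes f: "continuous_on circle f" and x: "x \<in> circle"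
  obtains \<delta> where "\<delta> > 0"
    "\<And>y. y \<in> circle \<Longrightarrow> dist y x < \<delta> \<Longrightarrow> (\<lambda>n. (U ^^ n) f x - (U ^^ n) f y) \<longlonglongrightarrow> 0"
proof -
  obtain \<delta> where \<delta>: "\<delta> > 0" "\<And>y \<epsilon>. y \<in> circle \<Longrightarrow> dist y x < \<delta> \<Longrightarrow> \<epsilon> > 0 \<Longrightarrow>
      \<exists>w. set w \<subseteq> {1..k} \<and> dist (fold g w y) (fold g w x) < \<epsilon>"
    using contraction_near[OF x] by blast
  have "(\<lambda>n. (U ^^ n) f x - (U ^^ n) f y) \<longlonglongrightarrow> 0" if y: "y \<in> circle" "dist y x < \<delta>" for y
  proof (rule LIMSEQ_I)
    fix \<epsilon> :: real assume "\<epsilon> > 0"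
    \<comment> \<open>The scale \<open>d\<close> must be known before \<open>w\<close> is chosen,
      while the images under \<open>w\<close> can lie anywhere; compactness therefore makes
      equicontinuity uniform.\<close>
    have "\<exists>\<delta>>0. \<forall>\<phi>\<in>range (\<lambda>n. (U ^^ n) f). \<forall>v\<in>circle. dist v u < \<delta> \<longrightarrow> dist (\<phi> v) (\<phi> u) < e"
      if u: "u \<in> circle" and e: "e > 0" for u e
    proof -
      obtain d where "d > 0" "\<And>n v. v \<in> circle \<Longrightarrow> dist v u < d \<Longrightarrow> \<bar>(U ^^ n) f v - (U ^^ n) f u\<bar> < e"
        using U_iterates_equicontinuous[OF f u e] by blast
      then show ?thesis
        by (intro exI[of _ d]) (auto simp: dist_real_def)
    qed
    then obtain d where d: "d > 0" "\<And>\<phi> u v. \<phi> \<in> range (\<lambda>n. (U ^^ n) f) \<Longrightarrow> u \<in> circle \<Longrightarrow> v \<in> circle \<Longrightarrow>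
        dist v u < d \<Longrightarrow> dist (\<phi> v) (\<phi> u) < \<epsilon> / 3"
      using compact_uniformly_equicontinuous[of circle "range (\<lambda>n. (U ^^ n) f)" "\<epsilon> / 3"]
        \<open>\<epsilon> > 0\<close> compact_sphere by (metis divide_pos_pos zero_less_numeral)
    obtain w where w: "set w \<subseteq> {1..k}" "dist (fold g w y) (fold g w x) < d"
      using \<delta>(2)[OF y d(1)] by blast
    have in_circle: "fold g w z \<in> circle" if "z \<in> circle" for z
      using w(1) that g_in_circle by (induction w arbitrary: z) auto
    have near: "\<bar>(U ^^ n) f (fold g w y) - (U ^^ n) f (fold g w x)\<bar> < \<epsilon> / 3" for n
      using d(2)[OF rangeI in_circle[OF x] in_circle[OF y(1)] w(2)] by (simp add: dist_real_def)
    have "\<forall>\<^sub>F n in sequentially. \<bar>(U ^^ n) f (fold g w z) - (U ^^ (n + length w)) f z\<bar> < \<epsilon> / 3"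
      if "z \<in> circle" for z
      using tendstoD[OF word_tendsto_0[OF f w(1) that], of "\<epsilon> / 3"] \<open>\<epsilon> > 0\<close> by (simp add: dist_real_def)
    then have "\<forall>\<^sub>F n in sequentially. \<bar>(U ^^ n) f (fold g w x) - (U ^^ (n + length w)) f x\<bar> < \<epsilon> / 3 \<and>
        \<bar>(U ^^ n) f (fold g w y) - (U ^^ (n + length w)) f y\<bar> < \<epsilon> / 3"
      using x y(1) by (intro eventually_conj) auto
    then have "\<forall>\<^sub>F n in sequentially. \<bar>(U ^^ (n + length w)) f x - (U ^^ (n + length w)) f y\<bar> < \<epsilon>"
    proof (rule eventually_mono)
      fix n
      assume "\<bar>(U ^^ n) f (fold g w x) - (U ^^ (n + length w)) f x\<bar> < \<epsilon> / 3 \<and>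
          \<bar>(U ^^ n) f (fold g w y) - (U ^^ (n + length w)) f y\<bar> < \<epsilon> / 3"
      then show "\<bar>(U ^^ (n + length w)) f x - (U ^^ (n + length w)) f y\<bar> < \<epsilon>"
        using near[of n] by linarith
    qed
    \<comment> \<open>The word is fixed while \<open>n\<close> grows, so the shift by its length is
      harmless.\<close>
    then have "\<forall>\<^sub>F n in sequentially. \<bar>(U ^^ n) f x - (U ^^ n) f y\<bar> < \<epsilon>"
      by (rule eventually_sequentially_seg[THEN iffD1])
    then show "\<exists>N. \<forall>n\<ge>N. norm ((U ^^ n) f x - (U ^^ n) f y - 0) < \<epsilon>"
      by (simp add: eventually_sequentially)
  qed
  with \<delta>(1) that show ?thesis by blast
qed

text \<open>Having the same asymptotics is an equivalence relation with a neighbourhood of each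
  point in its class, and the circle is connected.\<close>

lemma asymptotically_constant:
  assumes f: "continuous_on circle f" and "x \<in> circle" "y \<in> circle"
  shows "(\<lambda>n. (U ^^ n) f x - (U ^^ n) f y) \<longlonglongrightarrow> 0"
proof (rule connected_equivalence_relation[where R = "\<lambda>x y. (\<lambda>n. (U ^^ n) f x - (U ^^ n) f y) \<longlonglongrightarrow> 0" and S = circle])
  show "connected circle"
    by (intro connected_sphere) simp
  show "(\<lambda>n. (U ^^ n) f v - (U ^^ n) f u) \<longlonglongrightarrow> 0" if "(\<lambda>n. (U ^^ n) f u - (U ^^ n) f v) \<longlonglongrightarrow> 0" for u v
    using tendsto_minus[OF that] by simp
  show "(\<lambda>n. (U ^^ n) f u - (U ^^ n) f w) \<longlonglongrightarrow> 0"
    if "(\<lambda>n. (U ^^ n) f u - (U ^^ n) f v) \<longlonglongrightarrow> 0" "(\<lambda>n. (U ^^ n) f v - (U ^^ n) f w) \<longlonglongrightarrow> 0" for u v w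
    using tendsto_add[OF that] by simp
  show "\<exists>T. openin (top_of_set circle) T \<and> u \<in> T \<and> (\<forall>v\<in>T. (\<lambda>n. (U ^^ n) f u - (U ^^ n) f v) \<longlonglongrightarrow> 0)"
    if u: "u \<in> circle" for u
  proof -
    obtain \<delta> where \<delta>: "\<delta> > 0" "\<And>y. y \<in> circle \<Longrightarrow> dist y u < \<delta> \<Longrightarrow> (\<lambda>n. (U ^^ n) f u - (U ^^ n) f y) \<longlonglongrightarrow> 0"
      using asymptotically_constant_near[OF f u] by blast
    have "openin (top_of_set circle) (circle \<inter> ball u \<delta>)"
      by (intro openin_open_Int open_ball)
    moreover have "u \<in> circle \<inter> ball u \<delta>"
      using u \<delta>(1) by simp
    moreover have "(\<lambda>n. (U ^^ n) f u - (U ^^ n) f v) \<longlonglongrightarrow> 0" if "v \<in> circle \<inter> ball u \<delta>" for v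
      using that by (intro \<delta>(2)) (simp_all add: dist_commute)
    ultimately show ?thesis by blast
  qed
qed (use assms in auto)

text \<open>All iterates have the same \<mu>-mean, so integrating
  \<open>(U ^^ n) f x - (U ^^ n) f y\<close> over \<open>y\<close> leaves the distance to the
  claimed limit; the integrand is dominated by \<open>2 * B\<close>.\<close>

lemma U_iterates_tendsto:
  assumes f: "continuous_on circle f" and x: "x \<in> circle"
  shows "(\<lambda>n. (U ^^ n) f x) \<longlonglongrightarrow> (\<integral>y. f y \<partial>\<mu>)"
proof -
  obtain B where B: "\<And>y. y \<in> circle \<Longrightarrow> \<bar>f y\<bar> \<le> B"
    using continuous_on_circle_bounded[OF f] by metis
  have int: "(\<integral>y. (U ^^ n) f y \<partial>\<mu>) = (\<integral>y. f y \<partial>\<mu>)" for n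
    by (induction n) (simp_all add: \<mu>_invariant continuous_on_U_iterate f)
  have "(\<lambda>n. \<integral>y. (U ^^ n) f x - (U ^^ n) f y \<partial>\<mu>) \<longlonglongrightarrow> (\<integral>y. 0 \<partial>\<mu>)"
  proof (rule integral_dominated_convergence[where w = "\<lambda>_. 2 * B"])
    show "(\<lambda>y. (U ^^ n) f x - (U ^^ n) f y) \<in> borel_measurable \<mu>" for n
      by (intro borel_measurable_circle sets_\<mu> continuous_on_diff continuous_on_const continuous_on_U_iterate f)
    show "AE y in \<mu>. (\<lambda>n. (U ^^ n) f x - (U ^^ n) f y) \<longlonglongrightarrow> 0"
      using asymptotically_constant[OF f x] space_circle_measure[OF sets_\<mu>] by (intro AE_I2) blast
    show "AE y in \<mu>. norm ((U ^^ n) f x - (U ^^ n) f y) \<le> 2 * B" for n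
    proof (rule AE_I2)
      fix y assume "y \<in> space \<mu>"
      then have "y \<in> circle"
        using space_circle_measure[OF sets_\<mu>] by blast
      then show "norm ((U ^^ n) f x - (U ^^ n) f y) \<le> 2 * B"
        using abs_U_iterate_le[of f B, OF B, of x n] abs_U_iterate_le[of f B, OF B, of y n] x
        unfolding real_norm_def by linarith
    qed
  qed simp_all
  moreover have "(\<integral>y. (U ^^ n) f x - (U ^^ n) f y \<partial>\<mu>) = (U ^^ n) f x - (\<integral>y. f y \<partial>\<mu>)" for n
    using int prob_space by (subst Bochner_Integration.integral_diff) (simp_all add: integrable_\<mu> continuous_on_U_iterate f)
  ultimately have "(\<lambda>n. (U ^^ n) f x - (\<integral>y. f y \<partial>\<mu>)) \<longlonglongrightarrow> 0"
    by simp
  then show ?thesis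
    by (rule LIM_zero_cancel)
qed

lemma markov_op_iterates_tendsto:
  fixes f :: "complex \<Rightarrow> real"
  assumes \<rho>: "\<rho> \<in> prob_measures" and f: "continuous_on circle f"
  shows "(\<lambda>n. \<integral>x. f x \<partial>((markov_op k g p ^^ n) \<rho>)) \<longlonglongrightarrow> (\<integral>x. f x \<partial>\<mu>)"
proof -
  interpret R: prob_space \<rho>
    using \<rho> by (simp add: prob_measures_def)
  have sets_\<rho>: "sets \<rho> = sets circle_borel"
    using \<rho> by (simp add: prob_measures_def)
  obtain B where B: "\<And>y. y \<in> circle \<Longrightarrow> \<bar>f y\<bar> \<le> B"
    using continuous_on_circle_bounded[OF f] by metis
  have "(\<lambda>n. \<integral>x. (U ^^ n) f x \<partial>\<rho>) \<longlonglongrightarrow> (\<integral>x. (\<integral>y. f y \<partial>\<mu>) \<partial>\<rho>)"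
  proof (rule integral_dominated_convergence[where w = "\<lambda>_. B"])
    show "(U ^^ n) f \<in> borel_measurable \<rho>" for n
      by (intro borel_measurable_circle sets_\<rho> continuous_on_U_iterate f)
    show "AE x in \<rho>. (\<lambda>n. (U ^^ n) f x) \<longlonglongrightarrow> (\<integral>y. f y \<partial>\<mu>)"
      using U_iterates_tendsto[OF f] space_circle_measure[OF sets_\<rho>] by (intro AE_I2) blast
    show "AE x in \<rho>. norm ((U ^^ n) f x) \<le> B" for n
      using abs_U_iterate_le[of f B, OF B] space_circle_measure[OF sets_\<rho>]
      unfolding real_norm_def by (intro AE_I2) blast
  qed simp_all
  then show ?thesis
    using markov_op_iterate(2)[OF \<rho> f] R.prob_space by simp
qed

lemma asymptotically_stable: "asymptotically_stable k g p"
  unfolding asymptotically_stable_def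
proof (intro bexI conjI ballI allI impI)
  show \<mu>: "\<mu> \<in> prob_measures"
    by (simp add: prob_measures_def sets_\<mu> prob_\<mu>)
  show "invariant_measure k g p \<mu>"
    unfolding invariant_measure_def
    using markov_op_prob_and_integral[OF \<mu>] \<mu>_invariant \<mu> by (intro prob_measures_eqI) auto
  show "(\<lambda>n. \<integral>x. f x \<partial>((markov_op k g p ^^ n) \<rho>)) \<longlonglongrightarrow> (\<integral>x. f x \<partial>\<mu>)"
    if "\<rho> \<in> prob_measures" "continuous_on circle f" for \<rho> and f :: "complex \<Rightarrow> real"
    using that by (rule markov_op_iterates_tendsto)
  show "\<rho> = \<mu>" if \<rho>: "\<rho> \<in> prob_measures" "invariant_measure k g p \<rho>" for \<rho>
  proof (rule prob_measures_eqI[OF \<rho>(1) \<mu>])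
    fix f :: "complex \<Rightarrow> real" assume f: "continuous_on circle f"
    \<comment> \<open>For an invariant \<rho> the convergent sequence of integrals is constant,
      hence equal to its limit.\<close>
    have "(markov_op k g p ^^ n) \<rho> = \<rho>" for n
      by (induction n) (use \<rho>(2) in \<open>simp_all add: invariant_measure_def\<close>)
    then show "(\<integral>x. f x \<partial>\<rho>) = (\<integral>x. f x \<partial>\<mu>)"
      using markov_op_iterates_tendsto[OF \<rho>(1) f] by (simp add: LIMSEQ_const_iff)
  qed
qed

end

theorem theorem14:
  fixes k :: nat and g :: "nat \<Rightarrow> complex \<Rightarrow> complex" and p :: "nat \<Rightarrow> real"
  assumes "\<And>i. i \<in> {1..k} \<Longrightarrow> g i \<in> homeo_plus"
    and "admissible k g"
    and "contractive k g"
    and "\<And>i. i \<in> {1..k} \<Longrightarrow> p i > 0"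
    and "(\<Sum>i = 1..k. p i) = 1"
  shows "asymptotically_stable k g p"
proof -
  interpret admissible_ifs k g p
    by unfold_locales (fact assms)+
  \<comment> \<open>Two stationary measures play different parts: \<nu> for the inverse maps
    measures arcs and yields equicontinuity, \<mu> for the system itself is the limit.\<close>
  obtain \<nu> where \<nu>: "sets \<nu> = sets circle_borel" "prob_space \<nu>"
    "\<And>f. continuous_on circle f \<Longrightarrow> (\<integral>x. inverse.U f x \<partial>\<nu>) = (\<integral>x. f x \<partial>\<nu>)"
    using inverse.exists_invariant by blast
  obtain \<mu> where \<mu>: "sets \<mu> = sets circle_borel" "prob_space \<mu>"
    "\<And>f. continuous_on circle f \<Longrightarrow> (\<integral>x. U f x \<partial>\<mu>) = (\<integral>x. f x \<partial>\<mu>)"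
    using exists_invariant by blast
  interpret contractive_ifs k g p \<nu> \<mu>
    by (intro contractive_ifs.intro stationary_ifs.intro inverse_stationary.intro
        contractive_ifs_axioms.intro stationary_ifs_axioms.intro inverse_stationary_axioms.intro
        admissible_ifs_axioms) (fact \<nu> \<mu> assms)+
  show ?thesis
    by (rule asymptotically_stable)
qed

end
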